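(* Let $I\subset S^3$ be the vertex set of the regular $600$-cell ($120$ points). A subset of $I$ whose pairwise inner products are all at most $\frac12$ has at most $24$ elements; the subsets with $24$ elements are the twenty-five inscribed copies of $R$; and every subset with $23$ elements is one of those copies with a single vertex removed. In particular no saturated contact configuration of $23$ directions lies in $I$.
   Context: The regular $600$-cell inscribed in the unit sphere $S^3\subset\mathbb{R}^4$ has as vertices the $120$ unit icosians: with $\phi=\frac12(1+\sqrt5)$, the $8$ vectors $\pm e_i$, the $16$ vectors $\frac12(\pm1,\pm1,\pm1,\pm1)$, and the $96$ even permutations of $\frac12(\pm\phi,\pm1,\pm\phi^{-1},0)$. $R$ denotes the set of $24$ normalised $D_4$ roots $(\pm e_i\pm e_j)/\sqrt2$, $1\le i<j\le4$; a copy of $R$ is its image under an orthogonal map, and it is inscribed in $I$ if contained in $I$. "Pairwise" refers to distinct elements. A contact configuration is a finite set $W\subset S^3$ with $\langle w,w'\rangle\le\frac12$ for distinct $w,w'\in W$; one with bounded cell $V_c(W)=\{x\in\mathbb{R}^4:\langle x,w\rangle\le1\ \forall w\in W\}$ is saturated if no $v\in S^3$ satisfies $\langle v,w\rangle\le\frac12$ for all $w\in W$. *)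

theory Defs
  imports "HOL-Analysis.Analysis"
begin

definition phi :: real where
  "phi = (1 + sqrt 5) / 2"

definition icosian_units :: "(real^4) set" where
  "icosian_units = {s *\<^sub>R axis i 1 | s i. s \<in> {1, - 1}}"

definition icosian_halves :: "(real^4) set" where
  "icosian_halves = {(1/2) *\<^sub>R (\<chi> i. s i) | s. \<forall>i. s i \<in> {1, - 1}}"

definition icosian_golden :: "(real^4) set" where
  "icosian_golden =
     {(\<chi> i. v $ p i) | v p.
        v \<in> {(1/2) *\<^sub>R vector [a * phi, b, c * inverse phi, 0] | a b c.
               a \<in> {1, - 1} \<and> b \<in> {1, - 1} \<and> c \<in> {1, - 1}}
        \<and> p permutes UNIV \<and> evenperm p}"

definition cell600 :: "(real^4) set" where
  "cell600 = icosian_units \<union> icosian_halves \<union> icosian_golden"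

(* The signs s and t are independent, so requiring i \<noteq> j gives the same set as i < j
   and avoids referring to the order on the index type 4, in which 4 = 0. *)
definition D4_roots :: "(real^4) set" where
  "D4_roots =
     {(1 / sqrt 2) *\<^sub>R (s *\<^sub>R axis i 1 + t *\<^sub>R axis j 1) | s t i j.
        s \<in> {1, - 1} \<and> t \<in> {1, - 1} \<and> i \<noteq> j}"

definition is_copy :: "(real^4) set \<Rightarrow> (real^4) set \<Rightarrow> bool" where
  "is_copy C X \<longleftrightarrow> (\<exists>f. orthogonal_transformation f \<and> C = f ` X)"

definition inscribed_copies :: "(real^4) set set" where
  "inscribed_copies = {C. is_copy C D4_roots \<and> C \<subseteq> cell600}"

definition contact_configuration :: "(real^4) set \<Rightarrow> bool" where
  "contact_configuration W \<longleftrightarrow>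
     finite W \<and> W \<subseteq> sphere 0 1 \<and> pairwise (\<lambda>w w'. w \<bullet> w' \<le> 1/2) W"

definition contact_cell :: "(real^4) set \<Rightarrow> (real^4) set" where
  "contact_cell W = {x. \<forall>w\<in>W. x \<bullet> w \<le> 1}"

(* Saturation is only a notion for contact configurations with bounded cell, so both
   conditions are part of the predicate. *)
definition saturated :: "(real^4) set \<Rightarrow> bool" where
  "saturated W \<longleftrightarrow>
     contact_configuration W \<and> bounded (contact_cell W) \<and>
     \<not> (\<exists>v \<in> sphere 0 1. \<forall>w\<in>W. v \<bullet> w \<le> 1/2)"

end

(*
A point x of the 600-cell has twelve neighbours, at inner product phi/2, and they form an icosahedron.
By the Cauchy-Schwarz inequality at most three of them can have pairwise inner products at most 1/2.
Counting the pairs of a point of a packing S and a neighbour of it gives 12 |S| <= 3 (120 - |S|), that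
is |S| <= 24. If |S| >= 23, averaging the deficiencies in this count over S yields a point s of S such
that all but at most one neighbour of s have three neighbours in S. By symmetry s = 1. The points
at inner product 1/2 with s form a dodecahedron whose pentagons belong to the neighbours of s, and
counting modulo three shows that every pentagon contains exactly two points of S. Up to a rotation
of order five these are the diagonals of the pentagons that lie in the 24-cell T of all units and
halves, so S contains s and eight further points of T. Deleting the neighbours of these nine
points leaves 51 candidates, and greedy clique covers show that none of the 36 candidates outside T
can occur. So S is contained in one of the five rotations of T about s, and since each of the 120
points lies in exactly five copies of T there are 120 * 5 / 24 = 25 of them.
*)

theory Submission
  imports Defs
begin

section \<open>Integral coordinates\<close>

text \<open>A pair \<open>(a, b)\<close> encodes \<open>a + b\<phi>\<close>, and a quadruple of pairs encodes \<^emph>\<open>twice\<close> the vector with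
  these entries, so that all vertices of the 600-cell have integral codes.\<close>
type_synonym zphi = "int \<times> int"
type_synonym quad = "zphi \<times> zphi \<times> zphi \<times> zphi"

text \<open>The product in the ring generated by \<open>phi\<close> over the integers, reduced by
  \<open>phi * phi = phi + 1\<close>.\<close>

fun zmul :: "zphi \<Rightarrow> zphi \<Rightarrow> zphi" where
  "zmul (a, b) (c, d) = (a * c + b * d, a * d + b * c + b * d)"

fun zadd :: "zphi \<Rightarrow> zphi \<Rightarrow> zphi" where
  "zadd (a, b) (c, d) = (a + c, b + d)"

fun zneg :: "zphi \<Rightarrow> zphi" where
  "zneg (a, b) = (- a, - b)"

fun zdot :: "quad \<Rightarrow> quad \<Rightarrow> zphi" where
  "zdot (a, b, c, d) (e, f, g, h) = zadd (zadd (zmul a e) (zmul b f)) (zadd (zmul c g) (zmul d h))"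

text \<open>Codes are doubled vectors, so \<open>zdot\<close> is four times the inner product;
  \<open>(0, 2)\<close> therefore means inner product \<open>phi / 2\<close>, that is, an edge of
  the 600-cell.\<close>

definition adj :: "quad \<Rightarrow> quad \<Rightarrow> bool" where
  "adj x y \<longleftrightarrow> zdot x y = (0, 2)"

definition unit_quads :: "quad list" where
  "unit_quads = concat (map (\<lambda>s. [((s, 0), (0, 0), (0, 0), (0, 0)), ((0, 0), (s, 0), (0, 0), (0, 0)),
     ((0, 0), (0, 0), (s, 0), (0, 0)), ((0, 0), (0, 0), (0, 0), (s, 0))]) [2, - 2])"

definition half_quads :: "quad list" where
  "half_quads = map (\<lambda>(a, b, c, d). ((a, 0), (b, 0), (c, 0), (d, 0)))
     (List.product [1, - 1] (List.product [1, - 1] (List.product [1, - 1] [1, - 1])))"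

fun even_arrangements :: "'a \<Rightarrow> 'a \<Rightarrow> 'a \<Rightarrow> 'a \<Rightarrow> ('a \<times> 'a \<times> 'a \<times> 'a) list" where
  "even_arrangements a b c d =
    [(a, b, c, d), (a, c, d, b), (a, d, b, c), (b, a, d, c), (b, c, a, d), (b, d, c, a),
     (c, a, b, d), (c, b, d, a), (c, d, a, b), (d, a, c, b), (d, b, a, c), (d, c, b, a)]"

text \<open>The entry \<open>(- c, c)\<close> encodes \<open>c * (phi - 1)\<close>, which is
  \<open>c * inverse phi\<close>.\<close>

definition golden_quads :: "quad list" where
  "golden_quads = [q. a \<leftarrow> [1, - 1], b \<leftarrow> [1, - 1], c \<leftarrow> [1, - 1],
     q \<leftarrow> even_arrangements (0, a) (b, 0) (- c, c) (0, 0)]"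

definition quads :: "quad list" where
  "quads = unit_quads @ half_quads @ golden_quads"

lemma length_quads: "length quads = 120" by code_simp
lemma distinct_quads: "distinct quads" by code_simp

definition zval :: "zphi \<Rightarrow> real" where
  "zval p = (of_int (fst p) + of_int (snd p) * phi) / 2"

fun vec4 :: "quad \<Rightarrow> real^4" where
  "vec4 (a, b, c, d) = vector [zval a, zval b, zval c, zval d]"

lemma vector_4 [simp]:
  "(vector [a, b, c, d] :: 'a::zero^4) $ 1 = a" "(vector [a, b, c, d] :: 'a^4) $ 2 = b"
  "(vector [a, b, c, d] :: 'a^4) $ 3 = c" "(vector [a, b, c, d] :: 'a^4) $ 4 = d"
  unfolding vector_def by simp_all

lemma phi_sq: "phi * phi = phi + 1"
  by (simp add: phi_def field_simps)

lemma phi_gt_1: "phi > 1"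
  by (simp add: phi_def)

lemma inverse_phi: "inverse phi = phi - 1"
  using phi_sq phi_gt_1 by (simp add: field_simps)

text \<open>A reduced fraction m/n equal to \<open>phi\<close> satisfies m m = m n + n n. So n
  divides m m, hence n = 1; then m divides 1, and m = n = 1 violates the equation.\<close>

lemma phi_notin_Rats: "phi \<notin> \<rat>"
proof
  assume "phi \<in> \<rat>"
  then obtain m n :: nat where "n \<noteq> 0" and mn: "\<bar>phi\<bar> = real m / real n" and "coprime m n"
    by (rule Rats_abs_nat_div_natE)
  then have m: "real m = phi * real n"
    using phi_gt_1 \<open>n \<noteq> 0\<close> by (auto simp: field_simps)
  have "real m * real m = (phi * phi) * (real n * real n)"
    by (simp add: m)
  also have "\<dots> = real m * real n + real n * real n"
    by (simp add: phi_sq m algebra_simps)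
  finally have eq: "m * m = m * n + n * n"
    by (metis of_nat_add of_nat_eq_iff of_nat_mult)
  then have "n dvd m * m" by simp
  moreover have "coprime n (m * m)"
    using \<open>coprime m n\<close> by (simp add: coprime_commute)
  ultimately have "is_unit n"
    using coprime_absorb_left by blast
  then have "n = 1" by simp
  with eq have "m * m = m + 1" by simp
  then have "m dvd m + 1" by (metis dvd_triv_left)
  then have "m = 1" by (metis dvd_add_right_iff dvd_refl nat_dvd_1_iff_1)
  with \<open>m * m = m + 1\<close> show False by simp
qed

text \<open>Irrationality of \<open>phi\<close> makes 1 and \<open>phi\<close> independent over the
  rationals. This is what turns equations between real inner products into integer
  computations.\<close>

lemma zval_inject: "zval p = zval q \<longleftrightarrow> p = q"
proof
  assume eq: "zval p = zval q"
  obtain a b c d where [simp]: "p = (a, b)" "q = (c, d)" by (metis prod.exhaust)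
  have *: "of_int (b - d) * phi = of_int (c - a)"
    using eq by (simp add: zval_def algebra_simps)
  have "b = d"
  proof (rule ccontr)
    assume "b \<noteq> d"
    then have "phi = of_int (c - a) / of_int (b - d)"
      using * by (simp add: field_simps)
    then show False using phi_notin_Rats by (metis Rats_divide Rats_of_int)
  qed
  with * show "p = q" by simp
qed simp

lemma zval_zadd: "zval (zadd p q) = zval p + zval q"
  by (cases p; cases q) (simp add: zval_def add_divide_distrib algebra_simps)

lemma zval_zneg: "zval (zneg p) = - zval p"
  by (cases p) (simp add: zval_def field_simps)

text \<open>The factor 2 appears because \<open>zval\<close> halves each factor on the right but the
  product only once on the left.\<close>

lemma zval_zmul: "zval (zmul p q) = 2 * (zval p * zval q)"
proof -
  obtain a b c d where [simp]: "p = (a, b)" "q = (c, d)" by (metis prod.exhaust)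
  have "(of_int a + of_int b * phi) * (of_int c + of_int d * phi)
      = of_int (a * c) + of_int (a * d + b * c) * phi + of_int (b * d) * (phi * phi)"
    by (simp add: algebra_simps)
  then show ?thesis by (simp add: zval_def phi_sq algebra_simps)
qed

lemma vec4_inject: "vec4 x = vec4 y \<longleftrightarrow> x = y"
  by (cases x; cases y) (auto simp: vec_eq_iff forall_4 vector_4 zval_inject)

lemma inner_vec4: "vec4 x \<bullet> vec4 y = zval (zdot x y) / 2"
proof (cases x, cases y)
  fix a b c d e f g h
  assume "x = (a, b, c, d)" "y = (e, f, g, h)"
  then show ?thesis
    by (simp add: inner_vec_def sum_4 zval_zadd zval_zmul)
qed

lemma inner_vec4_eq_iff: "vec4 x \<bullet> vec4 y = zval p / 2 \<longleftrightarrow> zdot x y = p"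
  by (simp add: inner_vec4 zval_inject)

lemma adj_iff_inner: "adj x y \<longleftrightarrow> vec4 x \<bullet> vec4 y = phi / 2"
  using inner_vec4_eq_iff[of x y "(0, 2)"] by (simp add: adj_def zval_def)

lemma inner_half_iff: "vec4 x \<bullet> vec4 y = 1 / 2 \<longleftrightarrow> zdot x y = (2, 0)"
  using inner_vec4_eq_iff[of x y "(2, 0)"] by (simp add: zval_def)

section \<open>Identification of the vertices of the 600-cell with their codes\<close>

lemma vec4_eq_iff:
  "x = vec4 (a, b, c, d) \<longleftrightarrow> x $ 1 = zval a \<and> x $ 2 = zval b \<and> x $ 3 = zval c \<and> x $ 4 = zval d"
  by (simp add: vec_eq_iff forall_4 vector_4)

lemma icosian_units_eq: "icosian_units = vec4 ` set unit_quads"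
proof -
  have range: "range (\<lambda>i::4. s *\<^sub>R axis i (1::real)) = {vector [s, 0, 0, 0], vector [0, s, 0, 0],
      vector [0, 0, s, 0], vector [0, 0, 0, s]}" for s
  proof -
    have "s *\<^sub>R axis 1 1 = (vector [s, 0, 0, 0] :: real^4)" "s *\<^sub>R axis 2 1 = (vector [0, s, 0, 0] :: real^4)"
      "s *\<^sub>R axis 3 1 = (vector [0, 0, s, 0] :: real^4)" "s *\<^sub>R axis 4 1 = (vector [0, 0, 0, s] :: real^4)"
      by (simp_all add: vec_eq_iff forall_4 axis_def)
    then show ?thesis by (simp add: UNIV_4)
  qed
  have "icosian_units = (\<Union>s\<in>{1, - 1}. range (\<lambda>i. s *\<^sub>R axis i 1))"
    unfolding icosian_units_def by blast
  then show ?thesis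
    unfolding range by (simp add: unit_quads_def zval_def insert_commute)
qed

lemma set_half_quads:
  "set half_quads = (\<lambda>(a, b, c, d). ((a, 0), (b, 0), (c, 0), (d, 0))) `
     ({1, - 1} \<times> {1, - 1} \<times> {1, - 1} \<times> {1, - 1})"
  by (simp only: half_quads_def set_map set_product list.set)

lemma icosian_halves_eq: "icosian_halves = vec4 ` set half_quads"
proof (intro equalityI subsetI)
  fix x assume "x \<in> icosian_halves"
  then obtain s where x: "x = (1 / 2) *\<^sub>R (\<chi> i. s i)" and s: "\<forall>i. s i \<in> {1, - 1}"
    by (auto simp: icosian_halves_def)
  have "\<exists>a\<in>{1, - 1}. x $ i = zval (a, 0)" for i
    using s[rule_format, of i] by (auto simp: x zval_def)
  then obtain f where f: "f i \<in> {1, - 1}" "x $ i = zval (f i, 0)" for i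
    by metis
  then have "x = vec4 ((f 1, 0), (f 2, 0), (f 3, 0), (f 4, 0))"
    unfolding vec4_eq_iff by blast
  moreover have "(f 1, f 2, f 3, f 4) \<in> {1, - 1} \<times> {1, - 1} \<times> {1, - 1} \<times> {1, - 1}"
    using f(1) by blast
  ultimately show "x \<in> vec4 ` set half_quads"
    unfolding set_half_quads by (metis (mono_tags, lifting) case_prod_conv image_eqI)
next
  fix x assume "x \<in> vec4 ` set half_quads"
  then obtain q where q: "q \<in> {1, - 1} \<times> {1, - 1} \<times> {1, - 1} \<times> {1, - 1}"
    and "x = vec4 (case q of (a, b, c, d) \<Rightarrow> ((a, 0), (b, 0), (c, 0), (d, 0)))"
    unfolding set_half_quads image_image by (elim imageE)
  moreover obtain a b c d where "q = (a, b, c, d)" by (metis prod.exhaust)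
  ultimately have abcd: "a \<in> {1, - 1}" "b \<in> {1, - 1}" "c \<in> {1, - 1}" "d \<in> {1, - 1}"
    and x: "x = vec4 ((a, 0), (b, 0), (c, 0), (d, 0))"
    by (simp_all only: prod.case mem_Times_iff fst_conv snd_conv)
  have "2 * x $ i \<in> {1, - 1}" for i
    using exhaust_4[of i]
  proof (elim disjE)
    assume "i = 1" then show ?thesis using abcd(1) by (auto simp: x zval_def)
  next
    assume "i = 2" then show ?thesis using abcd(2) by (auto simp: x zval_def)
  next
    assume "i = 3" then show ?thesis using abcd(3) by (auto simp: x zval_def)
  next
    assume "i = 4" then show ?thesis using abcd(4) by (auto simp: x zval_def)
  qed
  then show "x \<in> icosian_halves"
    unfolding icosian_halves_def
    by (intro CollectI exI[of _ "\<lambda>i. 2 * x $ i"]) (simp add: vec_eq_iff)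
qed

text \<open>Every permutation of four points is a product of transpositions (1 a)(2 b)(3 c) with a,
  b, c at least 1, 2, 3. It is even iff an even number of the three are nontrivial, which is what
  the nested equality of truth values in \<open>even_T\<close> expresses.\<close>

lemma even_permutations_4:
  "{p :: 4 \<Rightarrow> 4. p permutes UNIV \<and> evenperm p} =
    (\<lambda>(i, j, k, l) n. if n = 1 then i else if n = 2 then j else if n = 3 then k else l) `
      set (even_arrangements 1 2 3 4)" (is "?L = ?f ` ?R")
proof -
  define T :: "4 \<Rightarrow> 4 \<Rightarrow> 4 \<Rightarrow> 4 \<Rightarrow> 4" where
    "T a b c = Transposition.transpose 1 a \<circ> (Transposition.transpose 2 b \<circ> Transposition.transpose 3 c)"
    for a b c
  have even_T: "evenperm (T a b c) \<longleftrightarrow> ((1 = a) = ((2 = b) = (3 = c)))" for a b c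
    by (simp add: T_def evenperm_comp evenperm_swap permutation_swap_id permutation_compose)
  have "{p. p permutes insert z A} =
      {Transposition.transpose z a \<circ> q | a q. a \<in> insert z A \<and> q permutes A}" for z :: 4 and A
    unfolding permutes_insert by auto
  note step = this[unfolded set_eq_iff mem_Collect_eq, rule_format]
  have "{p :: 4 \<Rightarrow> 4. p permutes UNIV} = {T a b c | a b c.
      a \<in> {1, 2, 3, 4} \<and> b \<in> {2, 3, 4} \<and> c \<in> {3, 4}}"
    unfolding UNIV_4 step permutes_empty T_def by (simp add: transpose_same) blast
  then have "?L = {p. evenperm p \<and> (\<exists>a\<in>{1, 2, 3, 4}. \<exists>b\<in>{2, 3, 4}. \<exists>c\<in>{3, 4}. p = T a b c)}"
    by (simp only: set_eq_iff mem_Collect_eq) blast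
  also have "\<dots> = (\<lambda>(a, b, c). T a b c) `
      {x \<in> {1, 2, 3, 4} \<times> {2, 3, 4} \<times> {3, 4}. case x of (a, b, c) \<Rightarrow> (1 = a) = ((2 = b) = (3 = c))}"
    (is "_ = _ ` ?X")
  proof (intro equalityI subsetI)
    fix p assume "p \<in> {p. evenperm p \<and>
      (\<exists>a\<in>{1, 2, 3, 4}. \<exists>b\<in>{2, 3, 4}. \<exists>c\<in>{3, 4}. p = T a b c)}"
    then obtain a b c where "a \<in> {1, 2, 3, 4}" "b \<in> {2, 3, 4}" "c \<in> {3, 4}" "p = T a b c" "evenperm p"
      by blast
    then have "(a, b, c) \<in> ?X" "p = T a b c" by (simp_all only: even_T) blast
    then show "p \<in> (\<lambda>(a, b, c). T a b c) ` ?X" by (metis (mono_tags, lifting) case_prod_conv image_eqI)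
  next
    fix p assume "p \<in> (\<lambda>(a, b, c). T a b c) ` ?X"
    then obtain a b c where *: "p = T a b c" "a \<in> {1, 2, 3, 4}" "b \<in> {2, 3, 4}" "c \<in> {3, 4}"
      and "(1 = a) = ((2 = b) = (3 = c))" by (elim imageE CollectE conjE SigmaE) simp
    then have "evenperm p" by (simp only: even_T)
    with * show "p \<in> {p. evenperm p \<and>
      (\<exists>a\<in>{1, 2, 3, 4}. \<exists>b\<in>{2, 3, 4}. \<exists>c\<in>{3, 4}. p = T a b c)}"
      by blast
  qed
  also have "?X = set [(1, 2, 3), (1, 3, 4), (1, 4, 4), (2, 2, 4), (2, 3, 3), (2, 4, 3),
       (3, 2, 4), (3, 3, 3), (3, 4, 3), (4, 2, 4), (4, 3, 3), (4, 4, 3)]"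
  proof -
    have "{1, 2, 3, 4 :: 4} \<times> {2, 3, 4 :: 4} \<times> {3, 4 :: 4} =
        set (List.product [1, 2, 3, 4] (List.product [2, 3, 4] [3, 4]))"
      by (simp only: set_product list.set)
    then show ?thesis
      by (simp only: set_filter[symmetric]) simp
  qed
  \<comment> \<open>The triples are put in the order of \<open>even_arrangements\<close>, so that
    the two images agree entry by entry.\<close>
  also have "\<dots> = {(1, 2, 3), (1, 3, 4), (1, 4, 4), (2, 2, 4), (2, 3, 3), (2, 4, 3),
       (3, 3, 3), (3, 2, 4), (3, 4, 3), (4, 4, 3), (4, 2, 4), (4, 3, 3)}"
    unfolding list.set by blast
  also have "(\<lambda>(a, b, c). T a b c) ` \<dots> = ?f ` ?R"
    unfolding even_arrangements.simps list.set image_insert image_empty prod.case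
    by (intro arg_cong2[of _ _ _ _ insert] refl)
       (simp_all add: T_def fun_eq_iff forall_4 Transposition.transpose_def)
  finally show ?thesis .
qed

lemma icosian_golden_eq: "icosian_golden = vec4 ` set golden_quads"
proof -
  define vecs where "vecs i j k l =
    (\<lambda>(i, j, k, l). vector [i, j, k, l] :: real^4) ` set (even_arrangements i j k l)" for i j k l
  have vecs: "(\<lambda>p. \<chi> i. v $ p i) ` {p. p permutes UNIV \<and> evenperm p}
      = vecs (v $ 1) (v $ 2) (v $ 3) (v $ 4)" for v
  proof -
    have "(\<chi> n. v $ (if n = 1 then i else if n = 2 then j else if n = 3 then k else l)) =
        (vector [v $ i, v $ j, v $ k, v $ l] :: real^4)" for i j k l :: 4
      by (simp add: vec_eq_iff forall_4)
    then show ?thesis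
      unfolding even_permutations_4 image_image vecs_def by simp
  qed
  have vecs_zval: "vecs (zval p) (zval q) (zval r) (zval s) = vec4 ` set (even_arrangements p q r s)"
    for p q r s
    by (simp add: vecs_def)
  \<comment> \<open>The signs are real numbers in \<open>icosian_golden\<close> and integers in the
    codes.\<close>
  have sign: "(\<exists>a::real. a \<in> {1, - 1} \<and> P a) \<longleftrightarrow> (\<exists>a\<in>{1, - 1}. P (of_int a))" for P
    by auto
  have "icosian_golden = {y. \<exists>a. a \<in> {1, - 1} \<and> (\<exists>b. b \<in> {1, - 1} \<and> (\<exists>c. c \<in> {1, - 1} \<and>
      y \<in> (\<lambda>p. \<chi> i. ((1/2) *\<^sub>R vector [a * phi, b, c * inverse phi, 0]) $ p i) `
        {p. p permutes UNIV \<and> evenperm p}))}"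
    unfolding icosian_golden_def by blast
  also have "\<dots> = {y. \<exists>a\<in>{1, - 1}. \<exists>b\<in>{1, - 1}. \<exists>c\<in>{1, - 1}.
      y \<in> vecs (zval (0, a)) (zval (b, 0)) (zval (- c, c)) (zval (0, 0))}"
    unfolding vecs sign by (simp only: zval_def inverse_phi vector_4 vector_scaleR_component)
      (simp del: insert_iff bex_simps add: algebra_simps diff_divide_distrib)
  also have "\<dots> = (\<Union>a\<in>{1, - 1}. \<Union>b\<in>{1, - 1}. \<Union>c\<in>{1, - 1}.
      vecs (zval (0, a)) (zval (b, 0)) (zval (- c, c)) (zval (0, 0)))"
    by blast
  also have "\<dots> = vec4 ` set golden_quads"
    unfolding vecs_zval golden_quads_def
    by (simp del: even_arrangements.simps vec4.simps add: image_Un Un_assoc)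
  finally show ?thesis .
qed

lemma cell600_eq: "cell600 = vec4 ` set quads"
  by (simp add: cell600_def icosian_units_eq icosian_halves_eq icosian_golden_eq quads_def image_Un Un_assoc)

lemma card_vec4_image: "card (vec4 ` A) = card A"
  by (rule card_image) (simp add: inj_on_def vec4_inject)

lemma card_cell600: "card cell600 = 120"
  using distinct_card[OF distinct_quads] by (simp add: cell600_eq card_vec4_image length_quads)

section \<open>Quaternionic symmetries\<close>

text \<open>Hamilton's product, the four coordinates being the coefficients of 1, i, j, k.\<close>

definition qmul :: "real^4 \<Rightarrow> real^4 \<Rightarrow> real^4" where
  "qmul x y = vector
    [x $ 1 * y $ 1 - x $ 2 * y $ 2 - x $ 3 * y $ 3 - x $ 4 * y $ 4,
     x $ 1 * y $ 2 + x $ 2 * y $ 1 + x $ 3 * y $ 4 - x $ 4 * y $ 3,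
     x $ 1 * y $ 3 - x $ 2 * y $ 4 + x $ 3 * y $ 1 + x $ 4 * y $ 2,
     x $ 1 * y $ 4 + x $ 2 * y $ 3 - x $ 3 * y $ 2 + x $ 4 * y $ 1]"

definition qconj :: "real^4 \<Rightarrow> real^4" where
  "qconj x = vector [x $ 1, - x $ 2, - x $ 3, - x $ 4]"

lemma orthogonal_transformation_qmul:
  assumes "norm x = 1"
  shows "orthogonal_transformation (qmul x)"
  unfolding orthogonal_transformation_def
proof (intro conjI allI)
  show "linear (qmul x)"
    by (intro linearI) (simp_all add: qmul_def vec_eq_iff forall_4 algebra_simps)
  fix v w
  \<comment> \<open>The polarised form of the multiplicativity of the quaternion norm.\<close>
  have "qmul x v \<bullet> qmul x w = (x \<bullet> x) * (v \<bullet> w)"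
    by (simp add: qmul_def inner_vec_def sum_4 algebra_simps)
  then show "qmul x v \<bullet> qmul x w = v \<bullet> w"
    using assms by (simp add: dot_square_norm)
qed

lemma orthogonal_transformation_qconj: "orthogonal_transformation qconj"
  unfolding orthogonal_transformation_def
  by (auto intro!: linearI simp: qconj_def vec_eq_iff forall_4 inner_vec_def sum_4)

fun zqprod :: "quad \<Rightarrow> quad \<Rightarrow> quad" where
  "zqprod (a, b, c, d) (e, f, g, h) =
    (zadd (zmul a e) (zneg (zadd (zmul b f) (zadd (zmul c g) (zmul d h)))),
     zadd (zmul a f) (zadd (zmul b e) (zadd (zmul c h) (zneg (zmul d g)))),
     zadd (zmul a g) (zadd (zneg (zmul b h)) (zadd (zmul c e) (zmul d f))),
     zadd (zmul a h) (zadd (zmul b g) (zadd (zneg (zmul c f)) (zmul d e))))"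

fun zhalf :: "zphi \<Rightarrow> zphi" where
  "zhalf (a, b) = (a div 2, b div 2)"

fun map4 :: "('a \<Rightarrow> 'b) \<Rightarrow> 'a \<times> 'a \<times> 'a \<times> 'a \<Rightarrow> 'b \<times> 'b \<times> 'b \<times> 'b" where
  "map4 f (a, b, c, d) = (f a, f b, f c, f d)"

text \<open>The product of two doubled quaternions has to be halved; the division is exact under the
  hypothesis of \<open>vec4_zqmul\<close> below, which holds for all products that are formed.\<close>
definition zqmul :: "quad \<Rightarrow> quad \<Rightarrow> quad" where
  "zqmul x y = map4 zhalf (zqprod x y)"

fun zqconj :: "quad \<Rightarrow> quad" where
  "zqconj (a, b, c, d) = (a, zneg b, zneg c, zneg d)"

lemma qconj_vec4: "qconj (vec4 x) = vec4 (zqconj x)"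
proof -
  obtain a b c d where "x = (a, b, c, d)" by (metis prod.exhaust)
  then show ?thesis by (simp add: qconj_def zval_zneg)
qed

lemma vec4_zqmul:
  assumes "map4 (\<lambda>p. zadd p p) (zqmul x y) = zqprod x y"
  shows "vec4 (zqmul x y) = qmul (vec4 x) (vec4 y)"
proof -
  obtain a b c d e f g h where xy: "x = (a, b, c, d)" "y = (e, f, g, h)"
    by (metis prod.exhaust)
  obtain p q r s where z: "zqmul x y = (p, q, r, s)" by (metis prod.exhaust)
  have double: "zval t = zval (zadd t t) / 2" for t
    by (simp add: zval_zadd)
  have eqs: "zadd p p = fst (zqprod x y)" "zadd q q = fst (snd (zqprod x y))"
    "zadd r r = fst (snd (snd (zqprod x y)))" "zadd s s = snd (snd (snd (zqprod x y)))"
    using assms unfolding z map4.simps by (metis fst_conv snd_conv)+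
  show ?thesis
    unfolding z vec4.simps double[of p] double[of q] double[of r] double[of s] eqs
    by (simp add: xy qmul_def zval_zadd zval_zneg zval_zmul vec_eq_iff forall_4)
qed

definition cell_symmetry :: "(real^4 \<Rightarrow> real^4) \<Rightarrow> bool" where
  "cell_symmetry f \<longleftrightarrow> orthogonal_transformation f \<and> f ` cell600 = cell600"

lemma finite_cell600: "finite cell600"
  by (simp add: cell600_eq)

text \<open>An injective map of a finite set into itself is onto, so the inclusion is all that has
  to be computed.\<close>

lemma cell_symmetryI:
  assumes "orthogonal_transformation f" "\<And>x. x \<in> set quads \<Longrightarrow> f (vec4 x) \<in> vec4 ` set quads"
  shows "cell_symmetry f"
proof -
  have "f ` cell600 \<subseteq> cell600" using assms(2) by (auto simp: cell600_eq)
  moreover have "inj_on f cell600"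
    using orthogonal_transformation_inj[OF assms(1)] by (rule inj_on_subset) simp
  ultimately show ?thesis
    using assms(1) finite_cell600 by (simp add: cell_symmetry_def endo_inj_surj)
qed

lemma cell_symmetry_comp: "cell_symmetry f \<Longrightarrow> cell_symmetry g \<Longrightarrow> cell_symmetry (f \<circ> g)"
  unfolding cell_symmetry_def image_comp[symmetric] by (simp add: orthogonal_transformation_compose)

lemma cell_symmetry_id: "cell_symmetry id"
  by (simp add: cell_symmetry_def orthogonal_transformation_id[unfolded id_def[symmetric]])

lemma cell_symmetry_funpow: "cell_symmetry f \<Longrightarrow> cell_symmetry (f ^^ n)"
  by (induction n) (auto intro: cell_symmetry_comp cell_symmetry_id)

lemma cell_symmetry_inv: "cell_symmetry f \<Longrightarrow> cell_symmetry (inv f)"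
  unfolding cell_symmetry_def
  by (metis bij_is_inj image_inv_f_f orthogonal_transformation_bij orthogonal_transformation_inv)

text \<open>The identity and two icosians, \<open>unit_h\<close> of order six and
  \<open>unit_g\<close> of order ten. Left multiplication by the latter two, together with
  conjugation, reaches all vertices from the identity.\<close>

definition unit_1 :: quad where "unit_1 = ((2, 0), (0, 0), (0, 0), (0, 0))"
definition unit_h :: quad where "unit_h = ((1, 0), (1, 0), (1, 0), (1, 0))"
definition unit_g :: quad where "unit_g = ((0, 1), (1, 0), (- 1, 1), (0, 0))"

text \<open>A computable certificate that left multiplication by \<open>g\<close> is a symmetry:
  norm one, products that are vertices again, and exact halving.\<close>

definition stable :: "quad \<Rightarrow> bool" where
  "stable g \<longleftrightarrow> zdot g g = (4, 0) \<and> list_all (\<lambda>x. zqmul g x \<in> set quads \<and>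
     map4 (\<lambda>p. zadd p p) (zqmul g x) = zqprod g x) quads"

lemma stable_units: "stable unit_h" "stable unit_g"
  by code_simp+

lemma norm_vec4_eq_1: "zdot g g = (4, 0) \<Longrightarrow> norm (vec4 g) = 1"
  by (simp add: norm_eq_sqrt_inner inner_vec4 zval_def)

lemma cell_symmetry_qmul: "stable g \<Longrightarrow> cell_symmetry (qmul (vec4 g))"
  by (intro cell_symmetryI orthogonal_transformation_qmul norm_vec4_eq_1)
     (auto simp: stable_def list_all_iff simp flip: vec4_zqmul)

lemma zqconj_quads: "list_all (\<lambda>x. zqconj x \<in> set quads) quads"
  by code_simp

lemma cell_symmetry_qconj: "cell_symmetry qconj"
  using zqconj_quads
  by (intro cell_symmetryI orthogonal_transformation_qconj) (auto simp: list_all_iff qconj_vec4)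

section \<open>Transitivity on the vertices, by exploring an orbit\<close>

fun push :: "'a list \<times> 'a list \<Rightarrow> 'a list \<Rightarrow> 'a list \<times> 'a list" where
  "push (seen, todo) new = (seen @ new, todo @ new)"

text \<open>One step of a breadth-first search: one vertex leaves the queue and its new images join
  it. A vertex is queued only once, so 120 steps are enough for the 120 vertices.\<close>

fun explore :: "quad list \<times> quad list \<Rightarrow> quad list \<times> quad list" where
  "explore (seen, []) = (seen, [])"
| "explore (seen, x # todo) = push (seen, todo)
     (filter (\<lambda>y. y \<notin> set seen) (remdups [zqmul unit_h x, zqmul unit_g x, zqconj x]))"

lemma explore_quads: "set quads \<subseteq> set (fst ((explore ^^ 120) ([unit_1], [unit_1])))"
  by code_simp

definition equivalent_1 :: "quad \<Rightarrow> bool" where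
  "equivalent_1 x \<longleftrightarrow> x \<in> set quads \<and> (\<exists>f. cell_symmetry f \<and> f (vec4 x) = vec4 unit_1)"

lemma equivalent_1_step:
  assumes "equivalent_1 x" "cell_symmetry g" "g (vec4 x) = vec4 y" "y \<in> set quads"
  shows "equivalent_1 y"
proof -
  obtain f where f: "cell_symmetry f" "f (vec4 x) = vec4 unit_1"
    using assms(1) by (auto simp: equivalent_1_def)
  have "inv g (vec4 y) = vec4 x"
    using assms(2) unfolding assms(3)[symmetric] cell_symmetry_def
    by (simp add: orthogonal_transformation_inj)
  with f show ?thesis
    unfolding equivalent_1_def using assms(2,4)
    by (intro conjI exI[of _ "f \<circ> inv g"]) (simp_all add: cell_symmetry_comp cell_symmetry_inv)
qed

text \<open>The search invariant: whatever is seen or queued can be moved to the identity by a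
  symmetry.\<close>

lemma explore_sound:
  assumes "\<forall>x \<in> set seen \<union> set todo. equivalent_1 x" "explore (seen, todo) = (seen', todo')"
  shows "\<forall>x \<in> set seen' \<union> set todo'. equivalent_1 x"
proof (cases todo)
  case (Cons x xs)
  then have x: "equivalent_1 x" using assms(1) by simp
  then have xq: "x \<in> set quads" by (simp add: equivalent_1_def)
  have mul: "equivalent_1 (zqmul g x)" if "stable g" for g
    using that xq vec4_zqmul[of g x]
    by (intro equivalent_1_step[OF x cell_symmetry_qmul[OF that]]) (auto simp: stable_def list_all_iff)
  have "equivalent_1 (zqconj x)"
    using zqconj_quads xq by (intro equivalent_1_step[OF x cell_symmetry_qconj qconj_vec4]) (auto simp: list_all_iff)
  with mul[OF stable_units(1)] mul[OF stable_units(2)] show ?thesis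
    using assms Cons by (auto simp del: remdups.simps)
qed (use assms in auto)

lemma explore_funpow_sound:
  "(explore ^^ n) ([unit_1], [unit_1]) = (seen, todo) \<Longrightarrow> \<forall>x \<in> set seen \<union> set todo. equivalent_1 x"
proof (induction n arbitrary: seen todo)
  case 0
  have "unit_1 \<in> set quads" by code_simp
  with 0 show ?case by (auto simp: equivalent_1_def intro: exI[of _ id] cell_symmetry_id)
next
  case (Suc n)
  obtain s t where st: "(explore ^^ n) ([unit_1], [unit_1]) = (s, t)" by (metis prod.exhaust)
  with Suc.prems have "explore (s, t) = (seen, todo)" by simp
  with Suc.IH[OF st] show ?case by (rule explore_sound)
qed

text \<open>Thanks to this, local statements about the 600-cell need computation at
  \<open>unit_1\<close> only.\<close>

lemma cell_symmetry_transitive: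
  assumes "x \<in> cell600"
  obtains f where "cell_symmetry f" "f x = vec4 unit_1"
proof -
  obtain q where q: "q \<in> set quads" "x = vec4 q" using assms by (auto simp: cell600_eq)
  obtain seen todo where eq: "(explore ^^ 120) ([unit_1], [unit_1]) = (seen, todo)"
    by (metis prod.exhaust)
  have "q \<in> set seen" using explore_quads q(1) by (auto simp only: eq fst_conv)
  then show ?thesis using explore_funpow_sound[OF eq] that q(2) by (auto simp: equivalent_1_def)
qed

section \<open>Double counting\<close>

abbreviation nbrs :: "real^4 \<Rightarrow> (real^4) set" where
  "nbrs x \<equiv> {y \<in> cell600. y \<bullet> x = phi / 2}"

definition packing :: "(real^4) set \<Rightarrow> bool" where
  "packing S \<longleftrightarrow> S \<subseteq> cell600 \<and> pairwise (\<lambda>x y. x \<bullet> y \<le> 1/2) S"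

text \<open>For n points the sum vector has inner product n \<open>phi\<close> / 2 with
  \<open>x\<close> and squared norm at most n (n + 1) / 2. Cauchy-Schwarz and \<open>phi_sq\<close>
  then give n (\<open>phi\<close> - 1) \<le> 2, which fails from n = 4 on because \<open>phi\<close>
  \<ge> 8/5.\<close>

lemma card_le_3_if_inner_phi:
  fixes x :: "'a::real_inner"
  assumes "finite A" "norm x = 1" "\<And>y. y \<in> A \<Longrightarrow> norm y = 1" "\<And>y. y \<in> A \<Longrightarrow> y \<bullet> x = phi / 2"
    and "pairwise (\<lambda>x y. x \<bullet> y \<le> 1/2) A"
  shows "card A \<le> 3"
proof -
  define n where "n = real (card A)"
  have "(\<Sum>y\<in>A. y \<bullet> x) = (\<Sum>y\<in>A. phi / 2)"
    using assms(4) by (intro sum.cong) auto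
  also have "\<dots> = n * (phi / 2)" by (simp add: n_def)
  finally have "(n * (phi / 2))\<^sup>2 = (\<Sum>A \<bullet> x)\<^sup>2"
    by (simp only: inner_sum_left)
  also have "\<dots> \<le> \<Sum>A \<bullet> \<Sum>A"
    using Cauchy_Schwarz_ineq[of "\<Sum>A" x] assms(2) by (simp add: dot_square_norm)
  also have "\<dots> = (\<Sum>y\<in>A. \<Sum>z\<in>A. y \<bullet> z)"
    unfolding inner_sum_left inner_sum_right by (rule sum.swap)
  also have "\<dots> \<le> (\<Sum>y\<in>A. 1 / 2 + n / 2)"
  proof (rule sum_mono)
    fix y assume "y \<in> A"
    then have "(\<Sum>z\<in>A. y \<bullet> z) = y \<bullet> y + (\<Sum>z\<in>A - {y}. y \<bullet> z)"
      using assms(1) by (simp add: sum.remove)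
    also have "\<dots> \<le> 1 + (\<Sum>z\<in>A - {y}. 1 / 2)"
      using assms(3,5) \<open>y \<in> A\<close> by (intro add_mono sum_mono) (auto simp: dot_square_norm pairwise_def)
    also have "\<dots> = 1 / 2 + n / 2"
    proof -
      have "card A \<ge> 1" using assms(1) \<open>y \<in> A\<close> by (metis One_nat_def Suc_leI card_gt_0_iff empty_iff)
      then show ?thesis using \<open>y \<in> A\<close> assms(1) by (simp add: n_def of_nat_diff field_simps)
    qed
    finally show "(\<Sum>z\<in>A. y \<bullet> z) \<le> 1 / 2 + n / 2" .
  qed
  also have "\<dots> = n * (1 / 2 + n / 2)" by (simp add: n_def)
  finally have "n * (n * (phi * phi)) \<le> n * (2 * (n + 1))"
    by (simp add: power2_eq_square field_simps)
  then have *: "n * (n * (phi + 1)) \<le> n * (2 * (n + 1))"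
    by (simp only: phi_sq)
  show ?thesis
  proof (rule ccontr)
    assume "\<not> card A \<le> 3"
    then have "n \<ge> 4" by (simp add: n_def)
    then have "n * (phi + 1) \<le> 2 * (n + 1)"
      using * by simp
    then have "n * (phi - 1) \<le> 2"
      by (simp add: algebra_simps)
    moreover have "phi \<ge> 8 / 5"
      unfolding phi_def using real_le_rsqrt[of "11/5" 5] by (simp add: power2_eq_square)
    then have "n * (phi - 1) \<ge> 4 * (3 / 5)"
      using \<open>n \<ge> 4\<close> by (intro mult_mono) auto
    ultimately show False by simp
  qed
qed

lemma norm_unit_1: "norm (vec4 unit_1) = 1"
  by (rule norm_vec4_eq_1) code_simp

lemma norm_cell600:
  assumes "x \<in> cell600"
  shows "norm x = 1"
proof -
  obtain f where "cell_symmetry f" "f x = vec4 unit_1"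
    using cell_symmetry_transitive[OF assms] .
  then show ?thesis
    using norm_unit_1 by (metis cell_symmetry_def orthogonal_transformation_norm)
qed

lemma cell_symmetry_inner: "cell_symmetry f \<Longrightarrow> f x \<bullet> f y = x \<bullet> y"
  by (simp add: cell_symmetry_def orthogonal_transformation_def)

lemma cell_symmetry_inj: "cell_symmetry f \<Longrightarrow> inj f"
  by (simp add: cell_symmetry_def orthogonal_transformation_inj)

lemma cell_symmetry_image_nbrs:
  assumes "cell_symmetry f"
  shows "f ` nbrs x = nbrs (f x)"
proof -
  have "nbrs (f x) = {y \<in> f ` cell600. y \<bullet> f x = phi / 2}"
    using assms by (simp add: cell_symmetry_def)
  also have "\<dots> = f ` nbrs x"
    using cell_symmetry_inner[OF assms] by auto
  finally show ?thesis ..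
qed

lemma cell600_filter: "{y \<in> cell600. P y} = vec4 ` set (filter (\<lambda>q. P (vec4 q)) quads)"
  by (auto simp: cell600_eq)

lemma card_vec4_image_filter: "card (vec4 ` set (filter P quads)) = length (filter P quads)"
proof -
  have "card (vec4 ` set (filter P quads)) = card (set (filter P quads))"
    by (rule card_vec4_image)
  also have "\<dots> = length (filter P quads)"
    by (rule distinct_card) (simp add: distinct_quads)
  finally show ?thesis .
qed

lemma length_nbrs_unit_1: "length (filter (\<lambda>q. adj q unit_1) quads) = 12"
  by code_simp

lemma card_nbrs:
  assumes "x \<in> cell600"
  shows "card (nbrs x) = 12"
proof -
  obtain f where f: "cell_symmetry f" "f x = vec4 unit_1"
    using cell_symmetry_transitive[OF assms] .
  have "card (nbrs x) = card (f ` nbrs x)"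
    using cell_symmetry_inj[OF f(1)] by (simp add: card_image inj_on_subset)
  also have "f ` nbrs x = nbrs (vec4 unit_1)"
    using cell_symmetry_image_nbrs[OF f(1)] f(2) by simp
  also have "\<dots> = vec4 ` set (filter (\<lambda>q. adj q unit_1) quads)"
    unfolding cell600_filter adj_iff_inner ..
  finally show ?thesis
    unfolding card_vec4_image_filter length_nbrs_unit_1 .
qed

lemma packing_finite: "packing S \<Longrightarrow> finite S"
  using finite_cell600 finite_subset by (auto simp: packing_def)

lemma packing_not_adj:
  assumes "packing S" "x \<in> S" "y \<in> S"
  shows "x \<bullet> y \<noteq> phi / 2"
proof (cases "x = y")
  case True
  have "x \<bullet> y = 1"
    using True norm_cell600[of x] assms by (auto simp: packing_def dot_square_norm)
  moreover have "phi \<noteq> 2" using phi_notin_Rats by (metis Rats_number_of)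
  ultimately show ?thesis by simp
next
  case False
  then have "x \<bullet> y \<le> 1/2" using assms by (auto simp: packing_def pairwise_def)
  then show ?thesis using phi_gt_1 by auto
qed

lemma packing_nbrs_le_3:
  assumes "packing S" "x \<in> cell600"
  shows "card (S \<inter> nbrs x) \<le> 3"
proof (rule card_le_3_if_inner_phi[of _ x])
  show "finite (S \<inter> nbrs x)" using finite_cell600 by simp
  show "pairwise (\<lambda>x y. x \<bullet> y \<le> 1 / 2) (S \<inter> nbrs x)"
    using assms(1) by (auto simp: packing_def pairwise_def)
qed (use assms norm_cell600 in auto)

text \<open>Each point of \<open>S\<close> has twelve neighbours, all outside \<open>S\<close>, and
  a point outside has three neighbours in \<open>S\<close> minus its deficiency. Counting these
  pairs both ways over the 120 - |S| points outside gives the identity.\<close>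

lemma packing_deficiency:
  assumes "packing S"
  shows "(\<Sum>x\<in>cell600 - S. 3 - card (S \<inter> nbrs x)) + 15 * card S = 360"
proof -
  let ?R = "cell600 - S"
  have S: "finite S" "S \<subseteq> cell600" using assms packing_finite by (auto simp: packing_def)
  have "(\<Sum>x\<in>?R. card {s \<in> S. s \<bullet> x = phi / 2}) = 12 * card S"
  proof (rule sum_multicount)
    have "{x \<in> ?R. s \<bullet> x = phi / 2} = nbrs s" if "s \<in> S" for s
      using packing_not_adj[OF assms that] by (auto simp: inner_commute)
    then show "\<forall>s\<in>S. card {x \<in> ?R. s \<bullet> x = phi / 2} = 12"
      using S card_nbrs by auto
  qed (use S finite_cell600 in auto)
  also have "(\<Sum>x\<in>?R. card {s \<in> S. s \<bullet> x = phi / 2}) = (\<Sum>x\<in>?R. card (S \<inter> nbrs x))"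
    using S by (intro sum.cong arg_cong[of _ _ card]) auto
  finally have "(\<Sum>x\<in>?R. 3 - card (S \<inter> nbrs x)) + 12 * card S =
      (\<Sum>x\<in>?R. (3 - card (S \<inter> nbrs x)) + card (S \<inter> nbrs x))"
    by (simp only: sum.distrib)
  \<comment> \<open>The truncated subtraction is exact since no count exceeds three.\<close>
  also have "\<dots> = (\<Sum>x\<in>?R. 3)"
    using packing_nbrs_le_3[OF assms] by (intro sum.cong) auto
  finally have "(\<Sum>x\<in>?R. 3 - card (S \<inter> nbrs x)) + 12 * card S = 3 * card ?R"
    by simp
  moreover have "card ?R + card S = 120"
    using S finite_cell600 card_cell600 card_mono[of cell600 S] by (simp add: card_Diff_subset)
  ultimately show ?thesis by simp
qed

definition deficient :: "(real^4) set \<Rightarrow> real^4 \<Rightarrow> (real^4) set" where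
  "deficient S s = {x \<in> nbrs s. card (S \<inter> nbrs x) \<noteq> 3}"

text \<open>A point of deficiency d \<ge> 1 is counted once for each of its 3 - d neighbours in
  \<open>S\<close>, and 3 - d \<le> 2 d. So the sum is at most twice the total deficiency 360 - 15
  |S|.\<close>

lemma sum_deficient_le:
  assumes "packing S"
  shows "(\<Sum>s\<in>S. card (deficient S s)) + 30 * card S \<le> 720"
proof -
  let ?D = "{x \<in> cell600 - S. card (S \<inter> nbrs x) \<noteq> 3}"
  have S: "finite S" "S \<subseteq> cell600" using assms packing_finite by (auto simp: packing_def)
  have fin: "finite (cell600 - S)" using finite_cell600 by simp
  have "deficient S s = {x \<in> ?D. x \<bullet> s = phi / 2}" if "s \<in> S" for s
    using packing_not_adj[OF assms _ that] by (auto simp: deficient_def)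
  then have "(\<Sum>s\<in>S. card (deficient S s)) = (\<Sum>s\<in>S. card {x \<in> ?D. x \<bullet> s = phi / 2})"
    by simp
  also have "\<dots> = (\<Sum>x\<in>?D. card (S \<inter> nbrs x))"
  proof (rule sum_multicount_gen)
    show "\<forall>x\<in>?D. card {s \<in> S. x \<bullet> s = phi / 2} = card (S \<inter> nbrs x)"
      using S by (intro ballI arg_cong[of _ _ card]) (auto simp: inner_commute)
  qed (use S fin in auto)
  also have "\<dots> \<le> (\<Sum>x\<in>?D. 2 * (3 - card (S \<inter> nbrs x)))"
  proof (rule sum_mono)
    fix x assume "x \<in> ?D"
    then show "card (S \<inter> nbrs x) \<le> 2 * (3 - card (S \<inter> nbrs x))"
      using packing_nbrs_le_3[OF assms, of x] by auto
  qed
  also have "\<dots> \<le> (\<Sum>x\<in>cell600 - S. 2 * (3 - card (S \<inter> nbrs x)))"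
    using fin by (intro sum_mono2) auto
  also have "\<dots> + 30 * card S = 720"
    using packing_deficiency[OF assms] by (simp flip: sum_distrib_left)
  finally show ?thesis by simp
qed

lemma packing_card_le: "packing S \<Longrightarrow> card S \<le> 24"
  using packing_deficiency[of S] by linarith

text \<open>If every point had two deficient neighbours, \<open>sum_deficient_le\<close> would give
  32 |S| \<le> 720, hence |S| \<le> 22.\<close>

lemma ex_deficient_le_1:
  assumes "packing S" "card S \<ge> 23"
  obtains s where "s \<in> S" "card (deficient S s) \<le> 1"
proof -
  have "\<exists>s\<in>S. card (deficient S s) \<le> 1"
  proof (rule ccontr)
    assume "\<not> ?thesis"
    then have "(\<Sum>s\<in>S. card (deficient S s)) \<ge> (\<Sum>s\<in>S. 2)"
      by (intro sum_mono) auto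
    then show False using sum_deficient_le[OF assms(1)] assms(2) by simp
  qed
  then show ?thesis using that by blast
qed

lemma deficient_24:
  assumes "packing S" "card S = 24" "s \<in> S"
  shows "card (deficient S s) = 0"
  using sum_deficient_le[OF assms(1)] assms packing_finite[OF assms(1)] by (simp add: sum_eq_0_iff)

section \<open>Packings around the identity\<close>

abbreviation e1 :: "real^4" where
  "e1 \<equiv> vec4 unit_1"

definition nbr_quads :: "quad list" where
  "nbr_quads = filter (\<lambda>x. adj x unit_1) quads"

definition shell_quads :: "quad list" where
  "shell_quads = filter (\<lambda>y. zdot y unit_1 = (2, 0)) quads"

text \<open>The shell is a dodecahedron, and for a neighbour \<open>x\<close> of
  \<open>unit_1\<close> this is the face of it belonging to \<open>x\<close>.\<close>

definition pentagon_quads :: "quad \<Rightarrow> quad list" where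
  "pentagon_quads x = filter (\<lambda>y. adj y x) shell_quads"

definition pentagon :: "(real^4) set \<Rightarrow> real^4 \<Rightarrow> (real^4) set" where
  "pentagon S x = {y \<in> S. y \<bullet> x = phi / 2 \<and> y \<bullet> e1 = 1 / 2}"

lemma nbrs_e1: "nbrs e1 = vec4 ` set nbr_quads"
  unfolding cell600_filter adj_iff_inner nbr_quads_def ..

lemma e1_in_cell600: "e1 \<in> cell600"
proof -
  have "unit_1 \<in> set quads" by code_simp
  then show ?thesis by (simp add: cell600_eq)
qed

text \<open>One of the at most three neighbours of \<open>x\<close> in \<open>S\<close> is
  \<open>e1\<close>, which is not in the pentagon.\<close>

lemma pentagon_le_2:
  assumes "packing S" "e1 \<in> S" "x \<in> nbrs e1"
  shows "card (pentagon S x) \<le> 2"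
proof -
  have "e1 \<bullet> e1 = 1" using norm_unit_1 by (simp add: dot_square_norm)
  then have "e1 \<notin> pentagon S x" by (simp add: pentagon_def)
  moreover have "insert e1 (pentagon S x) \<subseteq> S \<inter> nbrs x"
    using assms by (auto simp: pentagon_def packing_def inner_commute e1_in_cell600)
  moreover have "finite (S \<inter> nbrs x)" "finite (pentagon S x)"
    using packing_finite[OF assms(1)] by (simp_all add: pentagon_def)
  ultimately have "Suc (card (pentagon S x)) \<le> card (S \<inter> nbrs x)"
    using card_mono[of "S \<inter> nbrs x" "insert e1 (pentagon S x)"] by simp
  then show ?thesis using packing_nbrs_le_3[OF assms(1), of x] assms(3) by simp
qed

text \<open>Around a neighbour of \<open>e1\<close> the twelve neighbours form an icosahedron; a vertex of it that is
  neither \<open>e1\<close>, nor adjacent to \<open>e1\<close>, nor in the pentagon is the antipode of \<open>e1\<close>.\<close>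
lemma icosahedron_antipode:
  "list_all (\<lambda>x. list_all (\<lambda>y. y = unit_1 \<or> adj y unit_1 \<or> zdot y unit_1 = (2, 0) \<or>
     list_all (\<lambda>z. z = unit_1 \<or> z = y \<or> adj z unit_1 \<or> adj z y) (filter (\<lambda>z. adj z x) quads))
     (filter (\<lambda>z. adj z x) quads)) nbr_quads"
  by code_simp

text \<open>A neighbour \<open>y\<close> of \<open>x\<close> in \<open>S\<close> other than
  \<open>e1\<close> and outside the pentagon is opposite to \<open>e1\<close> in the icosahedron
  around \<open>x\<close>. All its other vertices are adjacent to \<open>e1\<close> or to
  \<open>y\<close>, so \<open>S\<close> would contain only these two of them instead of
  three.\<close>

lemma pentagon_ge_2:
  assumes "packing S" "e1 \<in> S" "x \<in> nbrs e1" "card (S \<inter> nbrs x) = 3"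
  shows "card (pentagon S x) \<ge> 2"
proof -
  have "S \<inter> nbrs x \<subseteq> insert e1 (pentagon S x)"
  proof (rule ccontr)
    assume "\<not> ?thesis"
    then obtain y where y: "y \<in> S" "y \<in> nbrs x" "y \<noteq> e1" "y \<bullet> e1 \<noteq> 1 / 2"
      by (auto simp: pentagon_def)
    have "z = e1 \<or> z = y" if z: "z \<in> S" "z \<in> nbrs x" for z
    proof -
      have "x \<in> vec4 ` set nbr_quads" using assms(3) unfolding nbrs_e1 .
      moreover have "y \<in> vec4 ` set quads" "z \<in> vec4 ` set quads"
        using y(2) z(2) unfolding cell600_eq by blast+
      ultimately obtain p q r where q: "x = vec4 p" "p \<in> set nbr_quads" "y = vec4 q"
        "q \<in> set quads" "z = vec4 r" "r \<in> set quads" by blast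
      have "adj q p" "adj r p" "q \<noteq> unit_1" "zdot q unit_1 \<noteq> (2, 0)" "\<not> adj q unit_1" "\<not> adj r unit_1"
        using y z packing_not_adj[OF assms(1) _ assms(2)]
        by (auto simp: q adj_iff_inner simp flip: inner_half_iff)
      then have "r = unit_1 \<or> r = q \<or> adj r q"
        using icosahedron_antipode q unfolding list_all_iff set_filter by blast
      moreover have "\<not> adj r q"
        using packing_not_adj[OF assms(1)] z y by (simp add: adj_iff_inner q)
      ultimately show ?thesis by (auto simp: q)
    qed
    then have "S \<inter> nbrs x \<subseteq> {e1, y}" by blast
    then have "card (S \<inter> nbrs x) \<le> card {e1, y}" by (intro card_mono) auto
    also have "\<dots> \<le> 2" by (simp add: card_insert_if)
    finally show False using assms(4) by simp
  qed
  moreover have "finite (pentagon S x)"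
    using packing_finite[OF assms(1)] by (simp add: pentagon_def)
  ultimately have "3 \<le> card (insert e1 (pentagon S x))"
    unfolding assms(4)[symmetric] by (intro card_mono) auto
  also have "\<dots> \<le> Suc (card (pentagon S x))" by (rule card_insert_le_m1) simp_all
  finally show ?thesis by simp
qed

text \<open>Three faces meet in each vertex of the dodecahedron; this is the source of the
  divisibility by three.\<close>

lemma shell_nbrs: "list_all (\<lambda>y. length (filter (\<lambda>x. adj y x) nbr_quads) = 3) shell_quads"
  by code_simp

lemma sum_pentagon:
  assumes "packing S"
  shows "(\<Sum>x\<in>nbrs e1. card (pentagon S x)) = 3 * card {y \<in> S. y \<bullet> e1 = 1 / 2}"
proof -
  let ?D = "{y \<in> S. y \<bullet> e1 = 1 / 2}"
  have "card {x \<in> nbrs e1. y \<bullet> x = phi / 2} = 3" if y: "y \<in> ?D" for y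
  proof -
    obtain q where q: "y = vec4 q" "q \<in> set quads"
      using y assms unfolding packing_def cell600_eq by blast
    have "q \<in> set shell_quads"
      using y q by (simp add: shell_quads_def flip: inner_half_iff)
    then have "length (filter (\<lambda>x. adj q x) nbr_quads) = 3"
      using shell_nbrs by (simp add: list_all_iff)
    moreover have "{x \<in> nbrs e1. y \<bullet> x = phi / 2} = vec4 ` set (filter (\<lambda>x. adj q x) nbr_quads)"
      unfolding nbrs_e1 by (auto simp: q adj_iff_inner)
    moreover have "card (vec4 ` set (filter (\<lambda>x. adj q x) nbr_quads)) =
        length (filter (\<lambda>x. adj q x) nbr_quads)"
      unfolding nbr_quads_def filter_filter by (rule card_vec4_image_filter)
    ultimately show ?thesis by (simp only:)
  qed
  then have "(\<Sum>x\<in>nbrs e1. card {y \<in> ?D. y \<bullet> x = phi / 2}) = 3 * card ?D"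
    using packing_finite[OF assms] by (intro sum_multicount) (auto simp: finite_cell600)
  moreover have "{y \<in> ?D. y \<bullet> x = phi / 2} = pentagon S x" for x
    by (auto simp: pentagon_def)
  ultimately show ?thesis by simp
qed

text \<open>At most one pentagon is not known to contain two points, and the total is divisible by three.\<close>
lemma pentagon_eq_2:
  assumes "packing S" "e1 \<in> S" "card (deficient S e1) \<le> 1" "x \<in> nbrs e1"
  shows "card (pentagon S x) = 2"
proof -
  have fin: "finite (nbrs e1)" by (simp add: finite_cell600)
  have card12: "card (nbrs e1) = 12" by (rule card_nbrs[OF e1_in_cell600])
  have "deficient S e1 \<subseteq> nbrs e1" by (auto simp: deficient_def)
  then have "finite (deficient S e1)" using fin by (rule finite_subset)
  then have "22 \<le> 2 * card (nbrs e1 - deficient S e1)"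
    using assms(3) card12 diff_card_le_card_Diff[of "deficient S e1" "nbrs e1"] by linarith
  also have "\<dots> = (\<Sum>x\<in>nbrs e1 - deficient S e1. 2)" by simp
  also have "\<dots> \<le> (\<Sum>x\<in>nbrs e1 - deficient S e1. card (pentagon S x))"
    using assms(1,2) by (intro sum_mono pentagon_ge_2) (auto simp: deficient_def)
  also have "\<dots> \<le> (\<Sum>x\<in>nbrs e1. card (pentagon S x))"
    using fin by (intro sum_mono2) auto
  \<comment> \<open>The eleven full pentagons give 22, and the next multiple of three is 24. The
    pentagons other than that of \<open>x\<close> supply at most 22 of these.\<close>
  finally have "24 \<le> (\<Sum>x\<in>nbrs e1. card (pentagon S x))"
    unfolding sum_pentagon[OF assms(1)] by presburger
  also have "\<dots> = card (pentagon S x) + (\<Sum>x\<in>nbrs e1 - {x}. card (pentagon S x))"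
    by (rule sum.remove[OF fin assms(4)])
  also have "\<dots> \<le> card (pentagon S x) + (\<Sum>x\<in>nbrs e1 - {x}. 2)"
    using assms(1,2) by (intro add_left_mono sum_mono pentagon_le_2) auto
  also have "\<dots> = card (pentagon S x) + 22"
    using card12 assms(4) fin by simp
  finally show ?thesis using pentagon_le_2[OF assms(1,2,4)] by simp
qed

text \<open>A purely combinatorial trace of a packing around \<open>unit_1\<close>, on codes: the
  inner product bound is weakened to non-adjacency.\<close>

definition tight :: "quad set \<Rightarrow> bool" where
  "tight S \<longleftrightarrow> S \<subseteq> set quads \<and> (\<forall>x\<in>S. \<forall>y\<in>S. \<not> adj x y) \<and>
     (\<forall>x\<in>set nbr_quads. card (S \<inter> set (pentagon_quads x)) = 2)"

lemma tight_preimage: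
  assumes "packing S" "e1 \<in> S" "card (deficient S e1) \<le> 1"
  shows "tight {q \<in> set quads. vec4 q \<in> S}"
proof -
  let ?Q = "{q \<in> set quads. vec4 q \<in> S}"
  have "card (?Q \<inter> set (pentagon_quads x)) = 2" if "x \<in> set nbr_quads" for x
  proof -
    have "q \<in> set (pentagon_quads x) \<longleftrightarrow>
        q \<in> set quads \<and> vec4 q \<bullet> vec4 x = phi / 2 \<and> vec4 q \<bullet> e1 = 1 / 2" for q
      unfolding pentagon_quads_def shell_quads_def set_filter mem_Collect_eq adj_iff_inner inner_half_iff
      by blast
    moreover have "S \<subseteq> vec4 ` set quads" using assms(1) by (simp add: packing_def cell600_eq)
    ultimately have "vec4 ` (?Q \<inter> set (pentagon_quads x)) = pentagon S (vec4 x)"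
      unfolding pentagon_def by blast
    moreover have "card (pentagon S (vec4 x)) = 2"
    proof (rule pentagon_eq_2[OF assms])
      show "vec4 x \<in> nbrs e1" unfolding nbrs_e1 using that by (rule imageI)
    qed
    ultimately show ?thesis
      using card_vec4_image[of "?Q \<inter> set (pentagon_quads x)"] by simp
  qed
  then show ?thesis
    using packing_not_adj[OF assms(1)] by (auto simp: tight_def adj_iff_inner)
qed

section \<open>Forced points and elimination by greedy clique covers\<close>

definition clique :: "quad list \<Rightarrow> bool" where
  "clique xs \<longleftrightarrow> list_all (\<lambda>x. list_all (\<lambda>y. x = y \<or> adj x y) xs) xs"

text \<open>If deleting \<open>y\<close> from the points still available in a pentagon leaves no two that are not
  adjacent, then \<open>y\<close> belongs to the packing.\<close>
definition forced :: "quad list \<Rightarrow> quad list" where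
  "forced xs = filter (\<lambda>y. clique (removeAll y xs)) xs"

definition propagate :: "quad list \<Rightarrow> quad list" where
  "propagate K = K @ concat (map (\<lambda>x. forced
     (filter (\<lambda>y. list_all (\<lambda>k. \<not> adj k y) K) (pentagon_quads x))) nbr_quads)"

text \<open>The two points of \<open>S\<close> in a pentagon are not adjacent to \<open>K\<close>,
  so they survive the filter. If a forced \<open>y\<close> were not in \<open>S\<close>, both would
  lie in the clique left after deleting \<open>y\<close> and so be adjacent.\<close>

lemma propagate_subset:
  assumes "tight S" "set K \<subseteq> S"
  shows "set (propagate K) \<subseteq> S"
proof
  fix y assume "y \<in> set (propagate K)"
  then consider "y \<in> set K" | x where "x \<in> set nbr_quads"
    "y \<in> set (forced (filter (\<lambda>y. list_all (\<lambda>k. \<not> adj k y) K) (pentagon_quads x)))"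
    by (auto simp: propagate_def)
  then show "y \<in> S"
  proof cases
    case 2
    define R where "R = filter (\<lambda>y. list_all (\<lambda>k. \<not> adj k y) K) (pentagon_quads x)"
    have "card (S \<inter> set (pentagon_quads x)) = 2"
      using assms(1) 2(1) by (simp add: tight_def)
    then obtain a b where ab: "S \<inter> set (pentagon_quads x) = {a, b}" "a \<noteq> b"
      unfolding card_2_iff by blast
    then have S: "a \<in> S" "b \<in> S" by auto
    then have not_adj: "\<not> adj k z" if "k \<in> set K" "z \<in> {a, b}" for k z
      using assms that by (auto simp: tight_def)
    have R: "a \<in> set R" "b \<in> set R"
      using ab not_adj by (auto simp: R_def list_all_iff)
    show ?thesis
    proof (rule ccontr)
      assume "y \<notin> S"
      with S R have "a \<in> set (removeAll y R)" "b \<in> set (removeAll y R)" by auto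
      moreover have "clique (removeAll y R)" using 2(2) by (simp add: forced_def R_def)
      ultimately have "adj a b" using ab(2) by (auto simp: clique_def list_all_iff)
      then show False using S assms(1) by (simp add: tight_def)
    qed
  qed (use assms(2) in auto)
qed

fun insert_clique :: "quad \<Rightarrow> quad list list \<Rightarrow> quad list list" where
  "insert_clique x [] = [[x]]"
| "insert_clique x (c # cs) = (if list_all (adj x) c then (x # c) # cs else c # insert_clique x cs)"

definition clique_cover :: "quad list \<Rightarrow> quad list list" where
  "clique_cover xs = fold insert_clique xs []"

text \<open>A set without adjacent points meets each clique at most once.\<close>

lemma card_le_length_cliques:
  assumes "\<forall>x\<in>S. \<forall>y\<in>S. \<not> adj x y" "finite S" "S \<subseteq> \<Union>(set ` set cs)"
    "\<forall>c\<in>set cs. \<forall>x\<in>set c. \<forall>y\<in>set c. x = y \<or> adj x y"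
  shows "card S \<le> length cs"
  using assms
proof (induction cs arbitrary: S)
  case (Cons c cs)
  have "card (S \<inter> set c) \<le> 1"
  proof -
    have "c \<in> set (c # cs)" by simp
    then have "\<forall>x\<in>S \<inter> set c. \<forall>y\<in>S \<inter> set c. x = y" using Cons.prems(1,4) by blast
    then show ?thesis by (simp add: card_le_Suc0_iff_eq)
  qed
  moreover have "card (S - set c) \<le> length cs"
    using Cons.prems by (intro Cons.IH) auto
  moreover have "card S = card (S \<inter> set c) + card (S - set c)"
    using Cons.prems(2) by (simp add: card_Int_Diff)
  ultimately show ?case by simp
qed simp

lemma adj_commute: "adj x y \<longleftrightarrow> adj y x"
  by (simp add: adj_iff_inner inner_commute)

lemma insert_clique_cliques:
  assumes "\<forall>c\<in>set cs. \<forall>x\<in>set c. \<forall>y\<in>set c. x = y \<or> adj x y" "c \<in> set (insert_clique z cs)"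
  shows "\<forall>x\<in>set c. \<forall>y\<in>set c. x = y \<or> adj x y"
  using assms
proof (induction cs)
  case (Cons d cs)
  show ?case
  proof (cases "list_all (adj z) d")
    case True
    with Cons.prems have c: "set c = insert z (set d) \<or> c \<in> set cs" by auto
    have adj_z: "\<forall>x\<in>set d. adj z x" using True by (simp only: list_all_iff)
    have old: "\<forall>x\<in>set d. \<forall>y\<in>set d. x = y \<or> adj x y"
      "\<forall>c\<in>set cs. \<forall>x\<in>set c. \<forall>y\<in>set c. x = y \<or> adj x y"
      using Cons.prems(1) unfolding list.set ball_simps by blast+
    show ?thesis
    proof (intro ballI)
      fix x y assume "x \<in> set c" "y \<in> set c"
      with c consider "c \<in> set cs" | "x \<in> set d" "y \<in> set d" | "x = y" | "x = z" "y \<in> set d" |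
        "x \<in> set d" "y = z"
        by (metis insert_iff)
      then show "x = y \<or> adj x y"
      proof cases
        case 1
        then show ?thesis using old(2) \<open>x \<in> set c\<close> \<open>y \<in> set c\<close> by blast
      next
        case 5
        then show ?thesis using adj_z by (simp add: adj_commute[of x z])
      qed (use old(1) adj_z in blast)+
    qed
  next
    case False
    with Cons.prems have "c = d \<or> c \<in> set (insert_clique z cs)" by simp
    moreover have "\<forall>c\<in>insert d (set cs). \<forall>x\<in>set c. \<forall>y\<in>set c. x = y \<or> adj x y"
      using Cons.prems(1) by (simp only: list.set)
    ultimately show ?thesis using Cons.IH by blast
  qed
qed simp

lemma insert_clique_Union: "\<Union>(set ` set (insert_clique z cs)) = insert z (\<Union>(set ` set cs))"
  by (induction cs) auto

lemma fold_insert_clique: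
  assumes "\<forall>c\<in>set cs. \<forall>x\<in>set c. \<forall>y\<in>set c. x = y \<or> adj x y"
  shows "(\<forall>c\<in>set (fold insert_clique xs cs). \<forall>x\<in>set c. \<forall>y\<in>set c. x = y \<or> adj x y) \<and>
    \<Union>(set ` set (fold insert_clique xs cs)) = set xs \<union> \<Union>(set ` set cs)"
  using assms
proof (induction xs arbitrary: cs)
  case (Cons x xs)
  have "\<forall>c\<in>set (insert_clique x cs). \<forall>x\<in>set c. \<forall>y\<in>set c. x = y \<or> adj x y"
    using insert_clique_cliques[OF Cons.prems] by blast
  from Cons.IH[OF this] show ?case by (simp add: insert_clique_Union)
qed simp

lemma card_le_clique_cover:
  assumes "\<forall>x\<in>S. \<forall>y\<in>S. \<not> adj x y" "finite S" "S \<subseteq> set xs"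
  shows "card S \<le> length (clique_cover xs)"
  using assms fold_insert_clique[of "[]" xs]
  by (intro card_le_length_cliques) (auto simp: clique_cover_def)

definition short_cover :: "nat \<Rightarrow> quad \<Rightarrow> quad list \<Rightarrow> bool" where
  "short_cover n b cand \<longleftrightarrow> length (clique_cover (filter (\<lambda>y. y \<noteq> b \<and> \<not> adj b y) cand)) \<le> n"

fun prune :: "nat \<Rightarrow> quad list \<Rightarrow> quad list \<Rightarrow> quad list" where
  "prune n cand [] = cand"
| "prune n cand (b # bs) = prune n (if short_cover n b cand then removeAll b cand else cand) bs"

text \<open>If a point \<open>b\<close> outside \<open>K\<close> were in \<open>S\<close>, the rest
  of \<open>S\<close> outside \<open>K\<close> would be covered by \<open>n\<close> cliques, so |S|
  would be at most \<open>length K + 1 + n\<close>. Each removal shrinks the later covers, which is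
  why the order of elimination matters.\<close>

lemma prune_sound:
  assumes "\<forall>x\<in>S. \<forall>y\<in>S. \<not> adj x y" "finite S" "length K + n + 1 < card S"
    "S \<subseteq> set K \<union> set cand"
  shows "S \<subseteq> set K \<union> set (prune n cand bs)"
  using assms(4)
proof (induction bs arbitrary: cand)
  case (Cons b bs)
  have "S \<subseteq> set K \<union> set (removeAll b cand)" if "short_cover n b cand"
  proof (cases "b \<in> S - set K")
    case True
    let ?xs = "filter (\<lambda>y. y \<noteq> b \<and> \<not> adj b y) cand"
    let ?X = "S - set K - {b}"
    have "card ?X \<le> length (clique_cover ?xs)"
      using assms(1,2) Cons.prems True by (intro card_le_clique_cover) auto
    also have "\<dots> \<le> n" using that by (simp add: short_cover_def)
    finally have "card ?X \<le> n" .
    moreover have "card S \<le> card (set K \<union> {b} \<union> ?X)"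
      using assms(2) by (intro card_mono) auto
    moreover have "\<dots> \<le> card (set K) + card {b} + card ?X"
      by (meson add_le_mono1 card_Un_le le_trans)
    ultimately show ?thesis using assms(3) card_length[of K] by simp
  qed (use Cons.prems in auto)
  with Cons show ?case by simp
qed simp

section \<open>The 24-cell of units and halves around the identity\<close>

definition root_quads :: "quad list" where
  "root_quads = unit_quads @ half_quads"

text \<open>The identity and the eight halves with first coordinate 1/2. The latter are the vertices
  of a cube inscribed in the dodecahedron, whose edges are one diagonal of each pentagon.\<close>

definition core_quads :: "quad list" where
  "core_quads = filter (\<lambda>x. zdot x unit_1 = (4, 0) \<or> zdot x unit_1 = (2, 0)) root_quads"

text \<open>The pentagon of \<open>unit_g\<close> in cyclic order. Its diagonal from
  \<open>pent0\<close> to \<open>pent3\<close> is the one lying in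
  \<open>root_quads\<close>.\<close>

definition pent0 :: quad where "pent0 = ((1, 0), (1, 0), (1, 0), (1, 0))"
definition pent1 :: quad where "pent1 = ((1, 0), (0, 1), (0, 0), (- 1, 1))"
definition pent2 :: quad where "pent2 = ((1, 0), (0, 1), (0, 0), (1, - 1))"
definition pent3 :: quad where "pent3 = ((1, 0), (1, 0), (1, 0), (- 1, 0))"
definition pent4 :: quad where "pent4 = ((1, 0), (- 1, 1), (0, 1), (0, 0))"

text \<open>One diagonal determines the whole inscribed cube: two rounds of forcing reach all of its
  vertices.\<close>

lemma propagate_core: "set core_quads \<subseteq> set (propagate (propagate [unit_1, pent0, pent3]))"
  by code_simp

text \<open>These orders, found by random search, make the greedy clique covers small enough.\<close>
definition candidates :: "quad list" where
  "candidates = map (nth quads)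
     [23, 21, 3, 4, 17, 22, 16, 1, 6, 20, 7, 5, 2, 19, 18,
      68, 43, 86, 74, 67, 91, 73, 101, 51, 53, 96, 108, 85, 100, 116, 109, 92, 90, 64, 98, 97, 42,
      111, 99, 84, 113, 115, 44, 52, 66, 65, 63, 114, 110, 72, 112]"

definition eliminations :: "quad list" where
  "eliminations = map (nth quads)
     [101, 51, 108, 100, 109, 73, 64, 111, 99, 84, 116, 86, 96, 113, 52, 65, 72, 110, 91, 115, 74,
      43, 67, 53, 85, 92, 90, 68, 98, 97, 42, 44, 66, 63, 114, 112]"

lemma quads_candidates:
  "list_all (\<lambda>q. list_ex (\<lambda>k. q = k \<or> adj k q) core_quads \<or> q \<in> set candidates) quads"
  by code_simp

text \<open>The value 12 is the largest that \<open>prune_sound\<close> admits for 23 points and a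
  core of nine, as 9 + 12 + 1 = 22.\<close>

lemma prune_candidates: "set (prune 12 candidates eliminations) \<subseteq> set root_quads"
  by code_simp

lemma length_core_quads: "length core_quads = 9"
  by code_simp

lemma tight_subset_roots:
  assumes "tight S" "card S \<ge> 23" "unit_1 \<in> S" "pent0 \<in> S" "pent3 \<in> S"
  shows "S \<subseteq> set root_quads"
proof -
  have core: "set core_quads \<subseteq> S"
  proof -
    have "set [unit_1, pent0, pent3] \<subseteq> S" using assms(3-5) by simp
    then have "set (propagate (propagate [unit_1, pent0, pent3])) \<subseteq> S"
      by (intro propagate_subset[OF assms(1)])
    with propagate_core show ?thesis by (rule order_trans)
  qed
  have S: "S \<subseteq> set quads" "\<forall>x\<in>S. \<forall>y\<in>S. \<not> adj x y" using assms(1) by (auto simp: tight_def)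
  then have fin: "finite S" by (meson List.finite_set finite_subset)
  have "S \<subseteq> set core_quads \<union> set candidates"
  proof
    fix q assume "q \<in> S"
    then have "\<forall>k\<in>set core_quads. \<not> adj k q" using core S by blast
    moreover have "list_ex (\<lambda>k. q = k \<or> adj k q) core_quads \<or> q \<in> set candidates"
      using quads_candidates \<open>q \<in> S\<close> S(1) unfolding list_all_iff by blast
    ultimately show "q \<in> set core_quads \<union> set candidates" by (auto simp: list_ex_iff)
  qed
  then have "S \<subseteq> set core_quads \<union> set (prune 12 candidates eliminations)"
    using assms(2) by (intro prune_sound S fin) (simp add: length_core_quads)
  also have "\<dots> \<subseteq> set root_quads"
    using prune_candidates by (auto simp: core_quads_def)
  finally show ?thesis .
qed

section \<open>Inscribed copies\<close>

lemma image_Collect_mem: "X \<subseteq> f ` A \<Longrightarrow> f ` {q \<in> A. f q \<in> X} = X"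
  by auto

text \<open>Conjugation by the icosian \<open>unit_g\<close> of order ten, a rotation of order five fixing \<open>e1\<close>.\<close>
definition rot :: "real^4 \<Rightarrow> real^4" where
  "rot = qmul (vec4 unit_g) \<circ> qconj \<circ> qmul (vec4 unit_g) \<circ> qconj"

definition zrot :: "quad \<Rightarrow> quad" where
  "zrot x = zqmul unit_g (zqconj (zqmul unit_g (zqconj x)))"

lemma rot_vec4: "x \<in> set quads \<Longrightarrow> rot (vec4 x) = vec4 (zrot x)"
  using stable_units(2) zqconj_quads
  by (simp add: rot_def zrot_def stable_def list_all_iff qconj_vec4 flip: vec4_zqmul)

text \<open>Conjugating g conj(x) gives x conj(g), so the composition is x |-> g x conj(g), made of
  maps already known to be symmetries.\<close>

lemma cell_symmetry_rot: "cell_symmetry rot"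
  unfolding rot_def
  by (intro cell_symmetry_comp cell_symmetry_qmul stable_units cell_symmetry_qconj)

lemma pent_quads:
  "unit_1 \<in> set quads" "pent0 \<in> set quads" "pent1 \<in> set quads" "pent2 \<in> set quads"
  "pent3 \<in> set quads" "pent4 \<in> set quads"
  by code_simp+

lemma zrot_simps:
  "zrot unit_1 = unit_1" "zrot pent0 = pent1" "zrot pent1 = pent2" "zrot pent2 = pent3"
  "zrot pent3 = pent4" "zrot pent4 = pent0"
  by code_simp+

lemma rot_simps:
  "rot e1 = e1" "rot (vec4 pent0) = vec4 pent1" "rot (vec4 pent1) = vec4 pent2"
  "rot (vec4 pent2) = vec4 pent3" "rot (vec4 pent3) = vec4 pent4" "rot (vec4 pent4) = vec4 pent0"
  using pent_quads by (simp_all add: rot_vec4 zrot_simps)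

lemma rot_funpow_e1: "(rot ^^ k) e1 = e1"
  by (induction k) (simp_all add: rot_simps)

lemma pentagon_quads_unit_g:
  "unit_g \<in> set nbr_quads" "pentagon_quads unit_g = [pent0, pent3, pent1, pent4, pent2]"
  by code_simp+

lemma adj_pent: "adj pent0 pent1" "adj pent1 pent2" "adj pent2 pent3" "adj pent3 pent4" "adj pent4 pent0"
  by code_simp+

text \<open>Two non-adjacent vertices of a five-cycle form one of its five diagonals. The cases are
  listed as the images of \<open>pent0\<close>, \<open>pent3\<close> under the successive powers of
  \<open>rot\<close>.\<close>

lemma tight_pent:
  assumes "tight S"
  shows "(pent0 \<in> S \<and> pent3 \<in> S) \<or> (pent1 \<in> S \<and> pent4 \<in> S) \<or> (pent2 \<in> S \<and> pent0 \<in> S) \<or>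
    (pent3 \<in> S \<and> pent1 \<in> S) \<or> (pent4 \<in> S \<and> pent2 \<in> S)"
proof -
  have "card (S \<inter> set (pentagon_quads unit_g)) = 2"
    using assms pentagon_quads_unit_g(1) by (simp add: tight_def)
  then obtain a b where ab: "S \<inter> {pent0, pent3, pent1, pent4, pent2} = {a, b}" "a \<noteq> b"
    unfolding pentagon_quads_unit_g card_2_iff list.set by blast
  then have S: "a \<in> S" "b \<in> S" "a \<in> {pent0, pent3, pent1, pent4, pent2}" "b \<in> {pent0, pent3, pent1, pent4, pent2}"
    by blast+
  moreover have "\<not> adj a b" "\<not> adj b a" using S assms by (auto simp: tight_def)
  ultimately show ?thesis using ab(2) adj_pent by blast
qed

lemma cell_symmetry_packing:
  assumes "cell_symmetry f" "packing S"
  shows "packing (f ` S)"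
proof -
  have "f ` S \<subseteq> cell600"
    using assms by (auto simp: cell_symmetry_def packing_def)
  moreover have "pairwise (\<lambda>x y. x \<bullet> y \<le> 1/2) (f ` S)"
    using assms(2) cell_symmetry_inner[OF assms(1)] by (auto simp: packing_def pairwise_def)
  ultimately show ?thesis by (simp add: packing_def)
qed

lemma cell_symmetry_card: "cell_symmetry f \<Longrightarrow> card (f ` S) = card S"
  using cell_symmetry_inj by (metis card_image inj_on_subset subset_UNIV)

lemma cell_symmetry_deficient:
  assumes "cell_symmetry f"
  shows "deficient (f ` S) (f s) = f ` deficient S s"
proof -
  have card_eq: "card (f ` S \<inter> nbrs (f x)) = card (S \<inter> nbrs x)" for x
    using cell_symmetry_card[OF assms, of "S \<inter> nbrs x"]
    by (simp only: image_Int[OF cell_symmetry_inj[OF assms]] cell_symmetry_image_nbrs[OF assms])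
  have "deficient (f ` S) (f s) = {x \<in> f ` nbrs s. card (f ` S \<inter> nbrs x) \<noteq> 3}"
    unfolding deficient_def cell_symmetry_image_nbrs[OF assms] ..
  also have "\<dots> = f ` {x \<in> nbrs s. card (f ` S \<inter> nbrs (f x)) \<noteq> 3}"
    by blast
  finally show ?thesis unfolding card_eq deficient_def .
qed

lemma inv_image_cell_symmetry:
  assumes "cell_symmetry f"
  shows "f ` inv f ` S = S"
  using assms by (simp add: cell_symmetry_def image_f_inv_f orthogonal_transformation_surj)

definition roots24 :: "(real^4) set" where
  "roots24 = vec4 ` set root_quads"

text \<open>The diagonal chosen by \<open>S\<close> in the pentagon of \<open>unit_g\<close> is
  turned back to \<open>pent0\<close>, \<open>pent3\<close>; there \<open>tight_subset_roots\<close>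
  applies, and the inclusion is turned forward again.\<close>

lemma packing_subset_rot_roots24:
  assumes "packing S" "e1 \<in> S" "card S \<ge> 23" "card (deficient S e1) \<le> 1"
  shows "\<exists>k<5. S \<subseteq> (rot ^^ k) ` roots24"
proof -
  have "tight {q \<in> set quads. vec4 q \<in> S}"
    using assms by (intro tight_preimage)
  note tight_pent[OF this]
  then have "(vec4 pent0 \<in> S \<and> vec4 pent3 \<in> S) \<or> (vec4 pent1 \<in> S \<and> vec4 pent4 \<in> S) \<or>
    (vec4 pent2 \<in> S \<and> vec4 pent0 \<in> S) \<or> (vec4 pent3 \<in> S \<and> vec4 pent1 \<in> S) \<or>
    (vec4 pent4 \<in> S \<and> vec4 pent2 \<in> S)"
    by blast
  moreover have "(rot ^^ 0) (vec4 pent0) = vec4 pent0" "(rot ^^ 0) (vec4 pent3) = vec4 pent3"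
    "(rot ^^ 1) (vec4 pent0) = vec4 pent1" "(rot ^^ 1) (vec4 pent3) = vec4 pent4"
    "(rot ^^ 2) (vec4 pent0) = vec4 pent2" "(rot ^^ 2) (vec4 pent3) = vec4 pent0"
    "(rot ^^ 3) (vec4 pent0) = vec4 pent3" "(rot ^^ 3) (vec4 pent3) = vec4 pent1"
    "(rot ^^ 4) (vec4 pent0) = vec4 pent4" "(rot ^^ 4) (vec4 pent3) = vec4 pent2"
    by (simp_all add: numeral_eq_Suc rot_simps)
  moreover have "(0::nat) < 5" "(1::nat) < 5" "(2::nat) < 5" "(3::nat) < 5" "(4::nat) < 5" by simp_all
  ultimately obtain k where k: "k < 5" "(rot ^^ k) (vec4 pent0) \<in> S" "(rot ^^ k) (vec4 pent3) \<in> S"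
    by metis
  define f where "f = rot ^^ k"
  have f: "cell_symmetry f" by (simp add: f_def cell_symmetry_funpow cell_symmetry_rot)
  have inv_f: "cell_symmetry (inv f)" using cell_symmetry_inv[OF f] .
  have inv_mem: "x \<in> inv f ` S" if "f x \<in> S" for x
    using that cell_symmetry_inj[OF f] by (metis image_eqI inv_f_f)
  have mem: "e1 \<in> inv f ` S" "vec4 pent0 \<in> inv f ` S" "vec4 pent3 \<in> inv f ` S"
    using k(2,3) assms(2) inv_mem rot_funpow_e1[of k] unfolding f_def[symmetric] by simp_all
  \<comment> \<open>Since the rotation fixes \<open>e1\<close>, the deficiency bound at
    \<open>e1\<close> passes to the rotated packing.\<close>
  have "inv f e1 = e1"
    using cell_symmetry_inj[OF f] by (metis f_def inv_f_f rot_funpow_e1)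
  then have "card (deficient (inv f ` S) e1) \<le> 1"
    using cell_symmetry_deficient[OF inv_f, of S e1] cell_symmetry_card[OF inv_f] assms(4) by simp
  then have "tight {q \<in> set quads. vec4 q \<in> inv f ` S}" (is "tight ?Q")
    using cell_symmetry_packing[OF inv_f assms(1)] mem by (intro tight_preimage)
  moreover have "inv f ` S \<subseteq> vec4 ` set quads"
    using cell_symmetry_packing[OF inv_f assms(1)] by (simp add: packing_def cell600_eq)
  then have image: "vec4 ` ?Q = inv f ` S" by (rule image_Collect_mem)
  then have "card ?Q \<ge> 23"
    using assms(3) cell_symmetry_card[OF inv_f, of S] card_vec4_image[of ?Q] by simp
  moreover have "unit_1 \<in> ?Q" "pent0 \<in> ?Q" "pent3 \<in> ?Q"
    using mem pent_quads by blast+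
  ultimately have "?Q \<subseteq> set root_quads"
    by (rule tight_subset_roots)
  then have "vec4 ` ?Q \<subseteq> vec4 ` set root_quads" by (rule image_mono)
  then have "inv f ` S \<subseteq> roots24" by (simp only: image roots24_def)
  then have "f ` inv f ` S \<subseteq> f ` roots24" by (rule image_mono)
  then show ?thesis using k(1) unfolding inv_image_cell_symmetry[OF f] unfolding f_def by (intro exI[of _ k] conjI)
qed

section \<open>The normalised D4 roots carried onto the units and halves\<close>

definition hadamard :: "real^4 \<Rightarrow> real^4" where
  "hadamard v = (1 / sqrt 2) *\<^sub>R vector [v $ 1 + v $ 2, v $ 1 - v $ 2, v $ 3 + v $ 4, v $ 3 - v $ 4]"

lemma orthogonal_transformation_hadamard: "orthogonal_transformation hadamard"
  unfolding orthogonal_transformation_def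
proof (intro conjI allI)
  show "linear hadamard"
    by (intro linearI) (simp_all add: hadamard_def vec_eq_iff forall_4 algebra_simps add_divide_distrib diff_divide_distrib)
  fix v w
  show "hadamard v \<bullet> hadamard w = v \<bullet> w"
    by (simp add: hadamard_def inner_vec_def sum_4 field_simps)
qed

text \<open>The codes of the images under \<open>hadamard\<close> of the basis vectors divided by
  \<open>sqrt 2\<close>.\<close>

definition zaxes :: "quad list" where
  "zaxes = [((1, 0), (1, 0), (0, 0), (0, 0)), ((1, 0), (- 1, 0), (0, 0), (0, 0)),
    ((0, 0), (0, 0), (1, 0), (1, 0)), ((0, 0), (0, 0), (1, 0), (- 1, 0))]"

fun zqadd :: "quad \<Rightarrow> quad \<Rightarrow> quad" where
  "zqadd (a, b, c, d) (e, f, g, h) = (zadd a e, zadd b f, zadd c g, zadd d h)"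

definition signed :: "quad \<Rightarrow> quad list" where
  "signed x = [x, map4 zneg x]"

definition signed_sums :: "quad \<Rightarrow> quad \<Rightarrow> quad list" where
  "signed_sums x y = concat (map (\<lambda>u. map (zqadd u) (signed y)) (signed x))"

definition hadamard_roots :: "quad list" where
  "hadamard_roots = concat (map (\<lambda>x. concat (map (signed_sums x) (filter (\<lambda>y. y \<noteq> x) zaxes))) zaxes)"

lemma hadamard_roots_eq: "set hadamard_roots \<subseteq> set root_quads" "set root_quads \<subseteq> set hadamard_roots"
  by code_simp+

lemma vec4_zqadd: "vec4 (zqadd x y) = vec4 x + vec4 y"
proof -
  obtain a b c d e f g h where "x = (a, b, c, d)" "y = (e, f, g, h)" by (metis prod.exhaust)
  then show ?thesis by (simp add: vec_eq_iff forall_4 zval_zadd)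
qed

lemma vec4_zneg: "vec4 (map4 zneg x) = - vec4 x"
proof -
  obtain a b c d where "x = (a, b, c, d)" by (metis prod.exhaust)
  then show ?thesis by (simp add: vec_eq_iff forall_4 zval_zneg)
qed

lemma UN_neq_range:
  "(\<Union>i. \<Union>j\<in>{j. b j \<noteq> b i}. F (b i) (b j)) = (\<Union>x\<in>range b. \<Union>y\<in>{y \<in> range b. y \<noteq> x}. F x y)"
  by blast

text \<open>By linearity a root is sent to a signed sum of two distinct members of
  \<open>zaxes\<close>, which leaves a comparison of two finite lists.\<close>

lemma hadamard_D4_roots: "hadamard ` D4_roots = roots24"
proof -
  define b :: "4 \<Rightarrow> quad" where "b i = (if i = 1 then zaxes ! 0 else if i = 2 then zaxes ! 1
    else if i = 3 then zaxes ! 2 else zaxes ! 3)" for i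
  have lin: "linear hadamard"
    using orthogonal_transformation_hadamard by (simp add: orthogonal_transformation_def)
  have axis: "hadamard ((1 / sqrt 2) *\<^sub>R axis i 1) = vec4 (b i)" for i
    using exhaust_4[of i]
    by (auto simp: hadamard_def b_def zaxes_def zval_def vec_eq_iff forall_4 axis_def)
  have image_singleton: "hadamard ` {x} = {hadamard x}" for x by simp
  have root: "hadamard ((1 / sqrt 2) *\<^sub>R (s *\<^sub>R axis i 1 + t *\<^sub>R axis j 1)) =
      s *\<^sub>R vec4 (b i) + t *\<^sub>R vec4 (b j)" for s t i j
  proof -
    have "(1 / sqrt 2) *\<^sub>R (s *\<^sub>R axis i 1 + t *\<^sub>R axis j 1 :: real^4) =
      s *\<^sub>R ((1 / sqrt 2) *\<^sub>R axis i 1) + t *\<^sub>R ((1 / sqrt 2) *\<^sub>R axis j 1)"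
      by (simp add: scaleR_add_right)
    then show ?thesis
      by (simp only: linear_add[OF lin] linear_cmul[OF lin, of s] linear_cmul[OF lin, of t] axis)
  qed
  have D4: "D4_roots = (\<Union>i. \<Union>j\<in>{j. j \<noteq> i}. \<Union>s\<in>{1, - 1}. \<Union>t\<in>{1, - 1}.
      {(1 / sqrt 2) *\<^sub>R (s *\<^sub>R axis i 1 + t *\<^sub>R axis j 1)})"
  proof (intro equalityI subsetI)
    fix x assume "x \<in> D4_roots"
    then obtain s t i j where "x = (1 / sqrt 2) *\<^sub>R (s *\<^sub>R axis i 1 + t *\<^sub>R axis j 1)"
      "s \<in> {1, - 1}" "t \<in> {1, - 1}" "i \<noteq> j"
      unfolding D4_roots_def mem_Collect_eq by (elim exE conjE)
    then show "x \<in> (\<Union>i. \<Union>j\<in>{j. j \<noteq> i}. \<Union>s\<in>{1, - 1}. \<Union>t\<in>{1, - 1}.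
        {(1 / sqrt 2) *\<^sub>R (s *\<^sub>R axis i 1 + t *\<^sub>R axis j 1)})"
      by (intro UN_I[of i] UN_I[of j] UN_I[of s] UN_I[of t]) simp_all
  next
    fix x :: "real^4" assume "x \<in> (\<Union>i. \<Union>j\<in>{j. j \<noteq> i}. \<Union>s\<in>{1, - 1}. \<Union>t\<in>{1, - 1}.
        {(1 / sqrt 2) *\<^sub>R (s *\<^sub>R axis i 1 + t *\<^sub>R axis j 1)})"
    then show "x \<in> D4_roots"
      unfolding D4_roots_def mem_Collect_eq
      by (elim UN_E) (intro exI conjI, erule singletonD, assumption+, simp)
  qed
  have "hadamard ` D4_roots = (\<Union>i. \<Union>j\<in>{j. j \<noteq> i}. \<Union>s\<in>{1, - 1}. \<Union>t\<in>{1, - 1}.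
      {s *\<^sub>R vec4 (b i) + t *\<^sub>R vec4 (b j)})"
    unfolding D4 image_UN image_singleton root ..
  also have "\<dots> = (\<Union>i. \<Union>j\<in>{j. j \<noteq> i}. vec4 ` set (signed_sums (b i) (b j)))"
    by (intro SUP_cong refl)
       (simp add: signed_sums_def signed_def vec4_zqadd vec4_zneg insert_commute)
  also have "\<dots> = (\<Union>i. \<Union>j\<in>{j. b j \<noteq> b i}. vec4 ` set (signed_sums (b i) (b j)))"
  proof -
    have "b j \<noteq> b i \<longleftrightarrow> j \<noteq> i" for i j
      using exhaust_4[of i] exhaust_4[of j] by (auto simp: b_def zaxes_def)
    then show ?thesis by simp
  qed
  also have "\<dots> = (\<Union>x\<in>range b. \<Union>y\<in>{y \<in> range b. y \<noteq> x}. vec4 ` set (signed_sums x y))"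
    by (rule UN_neq_range)
  also have "range b = set zaxes"
  proof -
    have b: "b 1 = zaxes ! 0" "b 2 = zaxes ! 1" "b 3 = zaxes ! 2" "b 4 = zaxes ! 3"
      by (simp_all add: b_def)
    have "set [p, q, r, s] = {[p, q, r, s] ! 0, [p, q, r, s] ! 1, [p, q, r, s] ! 2, [p, q, r, s] ! 3}"
      for p q r s :: quad
      by simp
    then have "set zaxes = {zaxes ! 0, zaxes ! 1, zaxes ! 2, zaxes ! 3}"
      unfolding zaxes_def .
    then show ?thesis
      unfolding UNIV_4 by (simp only: image_insert image_empty b)
  qed
  also have "(\<Union>x\<in>set zaxes. \<Union>y\<in>{y \<in> set zaxes. y \<noteq> x}. vec4 ` set (signed_sums x y)) =
      vec4 ` set hadamard_roots"
    by (simp add: hadamard_roots_def image_UN)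
  finally show ?thesis using hadamard_roots_eq by (simp add: roots24_def)
qed

text \<open>No \<open>phi\<close> occurs in these products, so the bound 1/2 is a comparison of
  integers.\<close>

lemma roots24_inner: "list_all (\<lambda>x. list_all (\<lambda>y. x = y \<or> (snd (zdot x y) = 0 \<and> fst (zdot x y) \<le> 2)) root_quads) root_quads"
  by code_simp

lemma packing_roots24: "packing roots24"
proof -
  have "x \<bullet> y \<le> 1 / 2" if xy: "x \<in> roots24" "y \<in> roots24" "x \<noteq> y" for x y
  proof -
    obtain p q where pq: "x = vec4 p" "y = vec4 q" "p \<in> set root_quads" "q \<in> set root_quads"
      using xy unfolding roots24_def by blast
    have "p = q \<or> snd (zdot p q) = 0 \<and> fst (zdot p q) \<le> 2"
      by (rule bspec[OF bspec[OF roots24_inner[unfolded list_all_iff] pq(3)] pq(4)])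
    moreover have "p \<noteq> q" using xy(3) pq(1,2) by blast
    ultimately have "snd (zdot p q) = 0" "fst (zdot p q) \<le> 2" by simp_all
    then show ?thesis by (simp add: pq inner_vec4 zval_def)
  qed
  then show ?thesis
    by (auto simp: packing_def pairwise_def roots24_def cell600_eq root_quads_def quads_def)
qed

lemma card_roots24: "card roots24 = 24"
proof -
  have "distinct root_quads" "length root_quads = 24" by code_simp+
  then have "card (set root_quads) = 24" by (simp add: distinct_card)
  then show ?thesis
    by (simp add: roots24_def card_vec4_image)
qed

lemma D4_roots_eq: "D4_roots = inv hadamard ` roots24"
  using orthogonal_transformation_inj[OF orthogonal_transformation_hadamard]
  by (simp add: image_inv_f_f flip: hadamard_D4_roots)

lemma roots24_copy: "roots24 \<in> inscribed_copies"
  using hadamard_D4_roots orthogonal_transformation_hadamard packing_roots24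
  by (auto simp: inscribed_copies_def is_copy_def packing_def)

lemma cell_symmetry_copy: "cell_symmetry f \<Longrightarrow> C \<in> inscribed_copies \<Longrightarrow> f ` C \<in> inscribed_copies"
  unfolding inscribed_copies_def is_copy_def cell_symmetry_def
  by (auto simp: image_comp intro: orthogonal_transformation_compose)

text \<open>Through \<open>hadamard\<close> every copy is also an orthogonal image of
  \<open>roots24\<close> and inherits its size and inner products.\<close>

lemma copy_packing:
  assumes "C \<in> inscribed_copies"
  shows "packing C" "card C = 24"
proof -
  obtain f where f: "orthogonal_transformation f" "C = f ` D4_roots" "C \<subseteq> cell600"
    using assms by (auto simp: inscribed_copies_def is_copy_def)
  define g where "g = f \<circ> inv hadamard"
  have g: "orthogonal_transformation g" "C = g ` roots24"
    unfolding g_def f(2) D4_roots_eq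
    by (simp_all add: image_comp orthogonal_transformation_compose f(1)
      orthogonal_transformation_inv orthogonal_transformation_hadamard)
  show "card C = 24"
    using card_roots24 orthogonal_transformation_inj[OF g(1)] by (simp add: g(2) card_image inj_on_subset)
  have "g x \<bullet> g y = x \<bullet> y" for x y
    using g(1) by (simp add: orthogonal_transformation_def)
  then show "packing C"
    using packing_roots24 f(3) by (auto simp: packing_def pairwise_def g(2))
qed

text \<open>A point with at most one deficient neighbour is moved to \<open>e1\<close>, and the
  rotated \<open>roots24\<close> found there is moved back.\<close>

lemma packing_subset_copy:
  assumes "packing S" "card S \<ge> 23"
  obtains C where "C \<in> inscribed_copies" "S \<subseteq> C"
proof -
  obtain s where s: "s \<in> S" "card (deficient S s) \<le> 1"
    using ex_deficient_le_1[OF assms] .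
  then have "s \<in> cell600" using assms(1) by (auto simp: packing_def)
  then obtain f where f: "cell_symmetry f" "f s = e1"
    using cell_symmetry_transitive by blast
  have "\<exists>k<5. f ` S \<subseteq> (rot ^^ k) ` roots24"
  proof (rule packing_subset_rot_roots24)
    show "packing (f ` S)" using f(1) assms(1) by (rule cell_symmetry_packing)
    show "e1 \<in> f ` S" using s(1) f(2) by (metis imageI)
    show "card (f ` S) \<ge> 23" using assms(2) by (simp add: cell_symmetry_card[OF f(1)])
    show "card (deficient (f ` S) e1) \<le> 1"
      using s(2) cell_symmetry_deficient[OF f(1), of S s] by (simp add: cell_symmetry_card[OF f(1)] f(2))
  qed
  then obtain k where "f ` S \<subseteq> (rot ^^ k) ` roots24" by blast
  then have "inv f ` f ` S \<subseteq> inv f ` (rot ^^ k) ` roots24" by (rule image_mono)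
  then have "S \<subseteq> inv f ` (rot ^^ k) ` roots24"
    using cell_symmetry_inj[OF f(1)] by (simp add: image_inv_f_f)
  moreover have "inv f ` (rot ^^ k) ` roots24 \<in> inscribed_copies"
    by (intro cell_symmetry_copy roots24_copy cell_symmetry_inv f cell_symmetry_funpow cell_symmetry_rot)
  ultimately show ?thesis using that by blast
qed

lemma finite_copy: "C \<in> inscribed_copies \<Longrightarrow> finite C"
  using copy_packing(1) packing_finite by blast

lemma packing_24_iff: "packing S \<and> card S = 24 \<longleftrightarrow> S \<in> inscribed_copies"
proof
  assume S: "packing S \<and> card S = 24"
  then obtain C where C: "C \<in> inscribed_copies" "S \<subseteq> C"
    using packing_subset_copy[of S] by auto
  then have "S = C"
    using S copy_packing(2)[OF C(1)] finite_copy[OF C(1)] by (intro card_subset_eq) auto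
  with C show "S \<in> inscribed_copies" by simp
qed (use copy_packing in auto)

section \<open>Counting the inscribed copies\<close>

lemma pent_roots24: "pent0 \<in> set root_quads" "pent3 \<in> set root_quads" "pent1 \<notin> set root_quads"
  "pent2 \<notin> set root_quads" "pent4 \<notin> set root_quads"
  by code_simp+

lemma rot_roots24_neq:
  assumes "0 < d" "d < 5"
  shows "(rot ^^ d) ` roots24 \<noteq> roots24"
proof -
  have roots: "vec4 q \<in> roots24 \<longleftrightarrow> q \<in> set root_quads" for q
    unfolding roots24_def by (rule inj_image_mem_iff) (simp add: inj_def vec4_inject)
  \<comment> \<open>The third power sends \<open>pent0\<close> to \<open>pent3\<close>, which stays
    in \<open>roots24\<close>; hence \<open>pent3\<close> is the witness there.\<close>
  have "(rot ^^ 1) (vec4 pent0) = vec4 pent1" "(rot ^^ 2) (vec4 pent0) = vec4 pent2"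
    "(rot ^^ 3) (vec4 pent3) = vec4 pent1" "(rot ^^ 4) (vec4 pent0) = vec4 pent4"
    by (simp_all add: numeral_eq_Suc rot_simps)
  moreover have "d = 1 \<or> d = 2 \<or> d = 3 \<or> d = 4" using assms by linarith
  ultimately have "\<exists>x\<in>roots24. (rot ^^ d) x \<notin> roots24"
    using roots pent_roots24 by metis
  then show ?thesis by blast
qed

lemma inj_on_rot_roots24: "inj_on (\<lambda>k. (rot ^^ k) ` roots24) {..<5}"
proof (rule linorder_inj_onI')
  fix k l :: nat assume kl: "k \<in> {..<5}" "l \<in> {..<5}" "k < l"
  show "(rot ^^ k) ` roots24 \<noteq> (rot ^^ l) ` roots24"
  proof
    assume "(rot ^^ k) ` roots24 = (rot ^^ l) ` roots24"
    also have "(rot ^^ l) ` roots24 = (rot ^^ k) ` (rot ^^ (l - k)) ` roots24"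
      using kl(3) by (simp add: image_comp flip: funpow_add)
    finally have "(rot ^^ (l - k)) ` roots24 = roots24"
      using cell_symmetry_inj[OF cell_symmetry_funpow[OF cell_symmetry_rot, of k]]
      by (simp add: inj_image_eq_iff)
    moreover have "0 < l - k" "l - k < 5" using kl by auto
    ultimately show False using rot_roots24_neq by blast
  qed
qed

text \<open>A copy has 24 points and thus no deficient neighbours, so it lies in a rotated
  \<open>roots24\<close>; equal size makes them equal.\<close>

lemma copies_at_e1: "{C \<in> inscribed_copies. e1 \<in> C} = (\<lambda>k. (rot ^^ k) ` roots24) ` {..<5}"
proof (intro equalityI subsetI)
  fix C assume C: "C \<in> {C \<in> inscribed_copies. e1 \<in> C}"
  then have p: "packing C" "card C = 24" "e1 \<in> C" using copy_packing by auto
  then have "\<exists>k<5. C \<subseteq> (rot ^^ k) ` roots24"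
    using deficient_24[OF p] by (intro packing_subset_rot_roots24) auto
  then obtain k where k: "k < 5" "C \<subseteq> (rot ^^ k) ` roots24" by blast
  have "(rot ^^ k) ` roots24 \<in> inscribed_copies"
    by (intro cell_symmetry_copy roots24_copy cell_symmetry_funpow cell_symmetry_rot)
  then have "C = (rot ^^ k) ` roots24"
    using k(2) p(2) copy_packing(2) finite_copy by (intro card_subset_eq) auto
  with k(1) show "C \<in> (\<lambda>k. (rot ^^ k) ` roots24) ` {..<5}" by blast
next
  fix C assume "C \<in> (\<lambda>k. (rot ^^ k) ` roots24) ` {..<5}"
  then obtain k where C: "C = (rot ^^ k) ` roots24" by blast
  have "unit_1 \<in> set root_quads" by code_simp
  then have "e1 \<in> C" unfolding C roots24_def by (metis imageI rot_funpow_e1)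
  then show "C \<in> {C \<in> inscribed_copies. e1 \<in> C}"
    unfolding C by (auto intro!: cell_symmetry_copy roots24_copy cell_symmetry_funpow cell_symmetry_rot)
qed

lemma card_copies_at:
  assumes "x \<in> cell600"
  shows "card {C \<in> inscribed_copies. x \<in> C} = 5"
proof -
  obtain f where f: "cell_symmetry f" "f x = e1"
    using cell_symmetry_transitive[OF assms] .
  have inj: "inj f" by (rule cell_symmetry_inj[OF f(1)])
  have image: "(`) f ` {C \<in> inscribed_copies. x \<in> C} = {C \<in> inscribed_copies. e1 \<in> C}"
  proof (intro equalityI subsetI)
    fix C assume "C \<in> {C \<in> inscribed_copies. e1 \<in> C}"
    then have "inv f ` C \<in> inscribed_copies" "inv f e1 \<in> inv f ` C" "f ` inv f ` C = C"
      using cell_symmetry_copy[OF cell_symmetry_inv[OF f(1)]] inv_image_cell_symmetry[OF f(1)] by auto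
    moreover have "inv f e1 = x" using inj f(2) by (metis inv_f_f)
    ultimately show "C \<in> (`) f ` {C \<in> inscribed_copies. x \<in> C}" by (metis (mono_tags, lifting) image_eqI mem_Collect_eq)
  next
    fix D assume "D \<in> (`) f ` {C \<in> inscribed_copies. x \<in> C}"
    then obtain C where "D = f ` C" "C \<in> inscribed_copies" "x \<in> C" by blast
    moreover from this have "e1 \<in> f ` C" using f(2) by (metis imageI)
    ultimately show "D \<in> {C \<in> inscribed_copies. e1 \<in> C}"
      using cell_symmetry_copy[OF f(1)] by simp
  qed
  have "inj_on ((`) f) {C \<in> inscribed_copies. x \<in> C}"
    using inj by (simp add: inj_on_def inj_image_eq_iff)
  then have "card {C \<in> inscribed_copies. x \<in> C} = card {C \<in> inscribed_copies. e1 \<in> C}"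
    unfolding image[symmetric] by (rule card_image[symmetric])
  also have "\<dots> = 5"
    unfolding copies_at_e1 card_image[OF inj_on_rot_roots24] by simp
  finally show ?thesis .
qed

text \<open>Incidences of vertices and copies: 120 times 5 equals 24 times the number of
  copies.\<close>

lemma card_inscribed_copies: "card inscribed_copies = 25"
proof -
  have "inscribed_copies \<subseteq> Pow cell600" by (auto simp: inscribed_copies_def)
  then have fin: "finite inscribed_copies" using finite_cell600 by (meson finite_Pow_iff finite_subset)
  have "{x \<in> cell600. x \<in> C} = C" if "C \<in> inscribed_copies" for C
    using that by (auto simp: inscribed_copies_def)
  then have "(\<Sum>x\<in>cell600. card {C \<in> inscribed_copies. x \<in> C}) = 24 * card inscribed_copies"
    using fin finite_cell600 copy_packing(2) by (intro sum_multicount) auto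
  then show ?thesis by (simp add: card_copies_at card_cell600)
qed

lemma packing_23:
  assumes "packing S" "card S = 23"
  obtains C v where "C \<in> inscribed_copies" "v \<in> C" "S = C - {v}"
proof -
  obtain C where C: "C \<in> inscribed_copies" "S \<subseteq> C"
    using packing_subset_copy[of S] assms by auto
  then have "card (C - S) = 1"
    using assms copy_packing(2)[OF C(1)] packing_finite by (simp add: card_Diff_subset)
  then obtain v where "C - S = {v}" by (auto simp: card_1_singleton_iff)
  with C that show ?thesis by blast
qed

text \<open>The vertex missing from the copy can be added back, which contradicts
  saturation.\<close>

lemma not_saturated_23: "\<not> (\<exists>W. saturated W \<and> card W = 23 \<and> W \<subseteq> cell600)"
proof clarify
  fix W assume W: "saturated W" "card W = 23" "W \<subseteq> cell600"
  then have "packing W" by (simp add: packing_def saturated_def contact_configuration_def)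
  then obtain C v where C: "C \<in> inscribed_copies" "v \<in> C" "W = C - {v}"
    using packing_23 W(2) by blast
  have "packing C" by (rule copy_packing[OF C(1)])
  then have "v \<in> sphere 0 1" "\<forall>w\<in>W. v \<bullet> w \<le> 1 / 2"
    using C norm_cell600 by (auto simp: packing_def pairwise_def)
  with W(1) show False by (auto simp: saturated_def)
qed

theorem proposition7p63:
  shows "card cell600 = 120
    \<and> (\<forall>S. S \<subseteq> cell600 \<and> pairwise (\<lambda>x y. x \<bullet> y \<le> 1/2) S \<longrightarrow> card S \<le> 24)
    \<and> {S. S \<subseteq> cell600 \<and> pairwise (\<lambda>x y. x \<bullet> y \<le> 1/2) S \<and> card S = 24} = inscribed_copies
    \<and> card inscribed_copies = 25
    \<and> (\<forall>S. S \<subseteq> cell600 \<and> pairwise (\<lambda>x y. x \<bullet> y \<le> 1/2) S \<and> card S = 23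
          \<longrightarrow> (\<exists>C \<in> inscribed_copies. \<exists>v \<in> C. S = C - {v}))
    \<and> \<not> (\<exists>W. saturated W \<and> card W = 23 \<and> W \<subseteq> cell600)"
proof (intro conjI allI impI)
  show "card cell600 = 120" by (rule card_cell600)
  show "card inscribed_copies = 25" by (rule card_inscribed_copies)
  show "\<not> (\<exists>W. saturated W \<and> card W = 23 \<and> W \<subseteq> cell600)" by (rule not_saturated_23)
  show "{S. S \<subseteq> cell600 \<and> pairwise (\<lambda>x y. x \<bullet> y \<le> 1/2) S \<and> card S = 24} = inscribed_copies"
    using packing_24_iff by (auto simp: packing_def)
  fix S :: "(real^4) set"
  show "card S \<le> 24" if "S \<subseteq> cell600 \<and> pairwise (\<lambda>x y. x \<bullet> y \<le> 1/2) S"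
    using that packing_card_le by (simp add: packing_def)
  show "\<exists>C \<in> inscribed_copies. \<exists>v \<in> C. S = C - {v}"
    if "S \<subseteq> cell600 \<and> pairwise (\<lambda>x y. x \<bullet> y \<le> 1/2) S \<and> card S = 23"
    using that packing_23[of S] unfolding packing_def by metis
qed

end
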